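(* Let $s>0$. Then there exists a constant $C_s>0$ such that for all $f,\varphi\in L^2(\mathbb{R}^2,\mathbb{H})$, $$\|f\|_{L^2(\mathbb{R}^2,\mathbb{H})}\,\|\varphi\|_{L^2(\mathbb{R}^2,\mathbb{H})}\leq C_s\left(\iint_{\mathbb{R}^2\times\mathbb{R}^2}|(\omega,y)|^{2s}\,|\mathcal{G}^{\varphi}_{A_1,A_2}\{f\}(\omega,y)|^2\,d\omega\,dy\right)^{\frac12}.$$
   Context: $\mathbb{H}$ is the algebra of real quaternions with units $i,j,k$, conjugation $\overline{q}$ and modulus $|q|=\sqrt{q\overline{q}}$. $L^2(\mathbb{R}^2,\mathbb{H})$ is the space of functions $f:\mathbb{R}^2\to\mathbb{H}$ with $\|f\|_{L^2(\mathbb{R}^2,\mathbb{H})}^2=\int_{\mathbb{R}^2}|f(x)|^2dx<\infty$. Fix real $2\times 2$ matrices $A_l=\begin{pmatrix}a_l&b_l\\c_l&d_l\end{pmatrix}$, $l=1,2$, with $a_ld_l-b_lc_l=1$ and $b_1b_2\neq 0$. Kernels: $K^{i}_{A_1}(x_1,\omega_1)=\frac{1}{\sqrt{2\pi b_1}}e^{\frac{i}{2}\left(\frac{a_1}{b_1}x_1^2-\frac{2}{b_1}x_1\omega_1+\frac{d_1}{b_1}\omega_1^2-\frac{\pi}{2}\right)}$ and $K^{j}_{A_2}(x_2,\omega_2)=\frac{1}{\sqrt{2\pi b_2}}e^{\frac{j}{2}\left(\frac{a_2}{b_2}x_2^2-\frac{2}{b_2}x_2\omega_2+\frac{d_2}{b_2}\omega_2^2-\frac{\pi}{2}\right)}$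 (for negative $b_1$, resp. $b_2$, the square root is the principal one in $\mathbb{R}+\mathbb{R}i$, resp. $\mathbb{R}+\mathbb{R}j$). For a window $\varphi$, the Gabor quaternion linear canonical transform of $f$ is $$\mathcal{G}^{\varphi}_{A_1,A_2}\{f\}(\omega,y)=\int_{\mathbb{R}^2}K^{i}_{A_1}(x_1,\omega_1)f(x)\overline{\varphi(x-y)}K^{j}_{A_2}(x_2,\omega_2)\,dx,\qquad \omega,y\in\mathbb{R}^2.$$ $|(\omega,y)|$ is the Euclidean norm on $\mathbb{R}^2\times\mathbb{R}^2$. *)

theory Defs
  imports "HOL-Analysis.Analysis"
begin

section \<open>The algebra of real quaternions\<close>

codatatype quat = Quat (qRe: real) (qIm1: real) (qIm2: real) (qIm3: real)

lemma quat_eqI [intro?]: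
  "\<lbrakk>qRe p = qRe q; qIm1 p = qIm1 q; qIm2 p = qIm2 q; qIm3 p = qIm3 q\<rbrakk> \<Longrightarrow> p = q"
  by (rule quat.expand) simp

lemma quat_eq_iff:
  "p = q \<longleftrightarrow> qRe p = qRe q \<and> qIm1 p = qIm1 q \<and> qIm2 p = qIm2 q \<and> qIm3 p = qIm3 q"
  by (auto intro: quat_eqI)

primcorec qi :: quat where
  "qRe qi = 0" | "qIm1 qi = 1" | "qIm2 qi = 0" | "qIm3 qi = 0"

primcorec qj :: quat where
  "qRe qj = 0" | "qIm1 qj = 0" | "qIm2 qj = 1" | "qIm3 qj = 0"

primcorec qk :: quat where
  "qRe qk = 0" | "qIm1 qk = 0" | "qIm2 qk = 0" | "qIm3 qk = 1"

primcorec qcnj :: "quat \<Rightarrow> quat" where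
  "qRe (qcnj q) = qRe q"
| "qIm1 (qcnj q) = - qIm1 q"
| "qIm2 (qcnj q) = - qIm2 q"
| "qIm3 (qcnj q) = - qIm3 q"

instantiation quat :: ab_group_add
begin

primcorec zero_quat where
  "qRe 0 = 0" | "qIm1 0 = 0" | "qIm2 0 = 0" | "qIm3 0 = 0"

primcorec plus_quat where
  "qRe (p + q) = qRe p + qRe q"
| "qIm1 (p + q) = qIm1 p + qIm1 q"
| "qIm2 (p + q) = qIm2 p + qIm2 q"
| "qIm3 (p + q) = qIm3 p + qIm3 q"

primcorec uminus_quat where
  "qRe (- q) = - qRe q"
| "qIm1 (- q) = - qIm1 q"
| "qIm2 (- q) = - qIm2 q"
| "qIm3 (- q) = - qIm3 q"

primcorec minus_quat where
  "qRe (p - q) = qRe p - qRe q"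
| "qIm1 (p - q) = qIm1 p - qIm1 q"
| "qIm2 (p - q) = qIm2 p - qIm2 q"
| "qIm3 (p - q) = qIm3 p - qIm3 q"

instance
  by standard (simp_all add: quat_eq_iff)

end

lemma quat_norm_sq_eq_0:
  "(qRe q)\<^sup>2 + (qIm1 q)\<^sup>2 + (qIm2 q)\<^sup>2 + (qIm3 q)\<^sup>2 = 0 \<longleftrightarrow> q = 0"
  by (simp add: quat_eq_iff add_nonneg_eq_0_iff)

instantiation quat :: real_div_algebra
begin

primcorec one_quat where
  "qRe 1 = 1" | "qIm1 1 = 0" | "qIm2 1 = 0" | "qIm3 1 = 0"

primcorec times_quat where
  "qRe (p * q) = qRe p * qRe q - qIm1 p * qIm1 q - qIm2 p * qIm2 q - qIm3 p * qIm3 q"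
| "qIm1 (p * q) = qRe p * qIm1 q + qIm1 p * qRe q + qIm2 p * qIm3 q - qIm3 p * qIm2 q"
| "qIm2 (p * q) = qRe p * qIm2 q - qIm1 p * qIm3 q + qIm2 p * qRe q + qIm3 p * qIm1 q"
| "qIm3 (p * q) = qRe p * qIm3 q + qIm1 p * qIm2 q - qIm2 p * qIm1 q + qIm3 p * qRe q"

primcorec scaleR_quat where
  "qRe (r *\<^sub>R q) = r * qRe q"
| "qIm1 (r *\<^sub>R q) = r * qIm1 q"
| "qIm2 (r *\<^sub>R q) = r * qIm2 q"
| "qIm3 (r *\<^sub>R q) = r * qIm3 q"

definition inverse_quat :: "quat \<Rightarrow> quat" where
  "inverse q = (1 / ((qRe q)\<^sup>2 + (qIm1 q)\<^sup>2 + (qIm2 q)\<^sup>2 + (qIm3 q)\<^sup>2)) *\<^sub>R qcnj q"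

definition divide_quat :: "quat \<Rightarrow> quat \<Rightarrow> quat" where
  "p div q = p * inverse q" for p q :: quat

instance
proof
  fix p :: quat
  let ?n = "(qRe p)\<^sup>2 + (qIm1 p)\<^sup>2 + (qIm2 p)\<^sup>2 + (qIm3 p)\<^sup>2"
  have *: "p * (r *\<^sub>R qcnj p) = (r * ?n) *\<^sub>R 1" "(r *\<^sub>R qcnj p) * p = (r * ?n) *\<^sub>R 1" for r
    by (simp_all add: quat_eq_iff algebra_simps power2_eq_square)
  have **: "(1::real) *\<^sub>R (1::quat) = 1"
    by (simp add: quat_eq_iff)
  assume "p \<noteq> 0"
  then have n: "?n \<noteq> 0"
    using quat_norm_sq_eq_0 by blast
  show "inverse p * p = 1" "p * inverse p = 1"
    unfolding inverse_quat_def * using n ** by simp_all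
qed (simp_all add: quat_eq_iff inverse_quat_def divide_quat_def algebra_simps)

end

lemma quat_units:
  "qi * qi = -1" "qj * qj = -1" "qk * qk = -1"
  "qi * qj = qk" "qj * qk = qi" "qk * qi = qj"
  "qj * qi = - qk" "qk * qj = - qi" "qi * qk = - qj"
  by (simp_all add: quat_eq_iff)

lemma quat_decomp: "q = qRe q *\<^sub>R 1 + qIm1 q *\<^sub>R qi + qIm2 q *\<^sub>R qj + qIm3 q *\<^sub>R qk"
  by (simp add: quat_eq_iff)

instantiation quat :: euclidean_space
begin

definition inner_quat :: "quat \<Rightarrow> quat \<Rightarrow> real" where
  "inner p q = qRe p * qRe q + qIm1 p * qIm1 q + qIm2 p * qIm2 q + qIm3 p * qIm3 q"

definition norm_quat :: "quat \<Rightarrow> real" where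
  "norm q = sqrt ((qRe q)\<^sup>2 + (qIm1 q)\<^sup>2 + (qIm2 q)\<^sup>2 + (qIm3 q)\<^sup>2)"

definition sgn_quat :: "quat \<Rightarrow> quat" where
  "sgn q = q /\<^sub>R norm q" for q :: quat

definition dist_quat :: "quat \<Rightarrow> quat \<Rightarrow> real" where
  "dist p q = norm (p - q)" for p q :: quat

definition uniformity_quat :: "(quat \<times> quat) filter" where
  "uniformity_quat = (INF e\<in>{0 <..}. principal {(p, q). dist p q < e})"

definition open_quat :: "quat set \<Rightarrow> bool" where
  "open U \<longleftrightarrow> (\<forall>p\<in>U. eventually (\<lambda>(p', q). p' = p \<longrightarrow> q \<in> U) uniformity)" for U :: "quat set"

definition Basis_quat :: "quat set" where
  "Basis = {1, qi, qj, qk}"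

instance
proof
  show "dist p q = norm (p - q)" for p q :: quat
    by (fact dist_quat_def)
  show "sgn q = q /\<^sub>R norm q" for q :: quat
    by (fact sgn_quat_def)
  show "(uniformity :: (quat \<times> quat) filter) = (INF e\<in>{0 <..}. principal {(p, q). dist p q < e})"
    by (fact uniformity_quat_def)
  show "open U \<longleftrightarrow> (\<forall>p\<in>U. eventually (\<lambda>(p', q). p' = p \<longrightarrow> q \<in> U) uniformity)"
    for U :: "quat set"
    by (fact open_quat_def)
  show "inner p q = inner q p" for p q :: quat
    by (simp add: inner_quat_def algebra_simps)
  show "inner (p + q) r = inner p r + inner q r" for p q r :: quat
    by (simp add: inner_quat_def algebra_simps)
  show "inner (c *\<^sub>R p) q = c * inner p q" for c and p q :: quat
    by (simp add: inner_quat_def algebra_simps)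
  show "0 \<le> inner p p" for p :: quat
    by (simp add: inner_quat_def)
  show "inner p p = 0 \<longleftrightarrow> p = 0" for p :: quat
    using quat_norm_sq_eq_0[of p] by (simp add: inner_quat_def power2_eq_square)
  show "norm p = sqrt (inner p p)" for p :: quat
    by (simp add: inner_quat_def norm_quat_def power2_eq_square)
  show "(Basis :: quat set) \<noteq> {}" "finite (Basis :: quat set)"
    by (simp_all add: Basis_quat_def)
  show "inner p q = (if p = q then 1 else 0)" if "p \<in> Basis" "q \<in> Basis" for p q :: quat
    using that by (auto simp: Basis_quat_def inner_quat_def quat_eq_iff)
  show "(\<forall>b\<in>Basis. inner p b = 0) \<longleftrightarrow> p = 0" for p :: quat
    by (auto simp: Basis_quat_def inner_quat_def intro: quat_eqI)
qed

end

instance quat :: real_normed_div_algebra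
proof
  fix p q :: quat
  show "norm (p * q) = norm p * norm q"
    by (simp add: norm_quat_def flip: real_sqrt_mult)
       (simp add: algebra_simps power2_eq_square)
qed

text \<open>The norm just defined is the modulus \<open>\<bar>q\<bar> = sqrt (q * qcnj q)\<close>.\<close>

lemma quat_mult_cnj: "q * qcnj q = of_real ((norm q)\<^sup>2)"
  by (simp add: norm_quat_def quat_eq_iff of_real_def power2_eq_square algebra_simps)

section \<open>The Gabor quaternion linear canonical transform\<close>

text \<open>For an imaginary unit \<open>u\<close>, the embedding of the complex numbers onto
  \<open>\<real> + \<real> u\<close> sending \<open>\<i>\<close> to \<open>u\<close>. It transports the principal square root \<open>csqrt\<close>.\<close>

definition slice :: "quat \<Rightarrow> complex \<Rightarrow> quat" where
  "slice u z = of_real (Re z) + of_real (Im z) * u"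

definition lct_kernel :: "quat \<Rightarrow> real^2^2 \<Rightarrow> real \<Rightarrow> real \<Rightarrow> quat" where
  "lct_kernel u A x \<omega> =
     (let a = A $ 1 $ 1; b = A $ 1 $ 2; d = A $ 2 $ 2 in
       1 / slice u (csqrt (of_real (2 * pi * b))) *
       exp (u / 2 * of_real (a / b * x\<^sup>2 - 2 / b * x * \<omega> + d / b * \<omega>\<^sup>2 - pi / 2)))"

text \<open>The plane is \<open>real \<times> real\<close>, whose library norm is the Euclidean one; so the norm on
  \<open>(real \<times> real) \<times> (real \<times> real)\<close> is the Euclidean norm of the four coordinates.\<close>

definition gabor_qlct ::
  "real^2^2 \<Rightarrow> real^2^2 \<Rightarrow> (real \<times> real \<Rightarrow> quat) \<Rightarrow> (real \<times> real \<Rightarrow> quat)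
    \<Rightarrow> real \<times> real \<Rightarrow> real \<times> real \<Rightarrow> quat" where
  "gabor_qlct A1 A2 \<phi> f \<omega> y =
     (LINT x|lebesgue.
        lct_kernel qi A1 (fst x) (fst \<omega>) * f x * qcnj (\<phi> (x - y)) *
        lct_kernel qj A2 (snd x) (snd \<omega>))"

definition L2_quat :: "(real \<times> real \<Rightarrow> quat) set" where
  "L2_quat = {f \<in> borel_measurable lebesgue. (\<integral>\<^sup>+ x. ennreal ((norm (f x))\<^sup>2) \<partial>lebesgue) < \<infinity>}"

definition L2_norm_quat :: "(real \<times> real \<Rightarrow> quat) \<Rightarrow> real" where
  "L2_norm_quat f = sqrt (LINT x|lebesgue. (norm (f x))\<^sup>2)"

text \<open>Square root on \<open>[0, \<infinity>]\<close>, needed because the weighted integral may diverge.\<close>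

definition ennreal_sqrt :: "ennreal \<Rightarrow> ennreal" where
  "ennreal_sqrt t = (if t = \<infinity> then \<infinity> else ennreal (sqrt (enn2real t)))"

end

theory Submission
  imports Defs "HOL-Probability.Characteristic_Functions"
begin

text \<open>The transform obeys the pointwise bound \<open>\<bar>G\<bar>\<^sup>2 \<le> c X\<close> with
  \<open>X = (\<parallel>f\<parallel> \<parallel>\<phi>\<parallel>)\<^sup>2\<close>, so on a ball of small volume it carries at most half of the energy \<open>X\<close>;
  the rest lies where the weight is at least \<open>r powr (2 s)\<close>. This needs only the lower half
  \<open>X \<le> \<integral>\<integral> \<bar>G\<bar>\<^sup>2\<close> of Plancherel's identity.

  For fixed \<open>y\<close>, chirps of modulus one reduce \<open>G(\<cdot>, y)\<close> to a two-sided quaternion Fourier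
  transform of an integrable \<open>H\<close>. Damping the frequency side by a Gaussian and expanding the
  square, the \<open>\<omega>\<close>-integral of the two kernels is a real Gaussian in \<open>x - x'\<close> (the imaginary
  parts are odd), which is also the autocorrelation of a narrower Gaussian \<open>\<rho>\<close>. Hence the damped
  energy is a multiple of \<open>\<integral> \<bar>\<rho> * H\<bar>\<^sup>2\<close>, and since \<open>\<rho> * H \<rightarrow> H\<close> in \<open>L\<^sup>1\<close>, Fatou's lemma along an
  almost everywhere convergent subsequence gives the inequality.\<close>

section \<open>Slices of the quaternions\<close>

text \<open>Bounded linearity carries the exponential series and Bochner integrals of complex
  functions over to the slice.\<close>

lemma slice_bounded_linear: "bounded_linear (slice u)"
proof
  show "slice u (x + y) = slice u x + slice u y" for x y
    by (simp add: slice_def algebra_simps)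
  show "slice u (r *\<^sub>R x) = r *\<^sub>R slice u x" for r x
    by (simp add: slice_def algebra_simps scaleR_conv_of_real)
  have "norm (slice u x) \<le> norm x * (1 + norm u)" for x
  proof -
    have "norm (slice u x) \<le> \<bar>Re x\<bar> + \<bar>Im x\<bar> * norm u"
      unfolding slice_def by (rule norm_triangle_le) (simp add: norm_mult)
    also have "\<dots> \<le> norm x + norm x * norm u"
      by (intro add_mono mult_right_mono abs_Re_le_cmod abs_Im_le_cmod) auto
    finally show ?thesis by (simp add: algebra_simps)
  qed
  then show "\<exists>K. \<forall>x. norm (slice u x) \<le> norm x * K" by blast
qed

lemma slice_1 [simp]: "slice u 1 = 1"
  by (simp add: slice_def)

lemma slice_of_real [simp]: "slice u (of_real r) = of_real r"
  by (simp add: slice_def)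

text \<open>On the real span of 1 and \<open>u\<close>, the relation \<open>u * u = -1\<close>
  reproduces complex multiplication. Hence quaternion factors from one slice commute and can be
  regrouped as complex numbers.\<close>

lemma slice_mult:
  assumes "u * u = -1"
  shows "slice u (z * w) = slice u z * slice u w"
proof -
  have "slice u v = Re v *\<^sub>R 1 + Im v *\<^sub>R u" for v
    by (simp add: slice_def of_real_def)
  then show ?thesis
    using assms by (simp add: algebra_simps mult.commute[of "Re w" "Im z"])
qed

lemma slice_power: "u * u = -1 \<Longrightarrow> slice u (z ^ n) = slice u z ^ n"
  by (induction n) (simp_all add: slice_mult)

lemma slice_exp:
  assumes "u * u = -1"
  shows "slice u (exp z) = exp (slice u z)"
proof -
  interpret bounded_linear "slice u" by (rule slice_bounded_linear)
  have "(\<lambda>n. slice u (z ^ n /\<^sub>R fact n)) sums slice u (exp z)"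
    by (intro sums exp_converges)
  then have "(\<lambda>n. slice u z ^ n /\<^sub>R fact n) sums slice u (exp z)"
    by (simp add: scaleR slice_power[OF assms])
  then show ?thesis
    using exp_converges sums_unique2 by blast
qed

lemma norm_slice:
  assumes "u = qi \<or> u = qj"
  shows "norm (slice u z) = norm z"
  using assms by (auto simp: slice_def norm_quat_def cmod_def of_real_def)

lemma slice_inverse:
  assumes "u * u = -1"
  shows "slice u (inverse z) = inverse (slice u z)"
proof (cases "z = 0")
  case False
  then show ?thesis
    by (intro inverse_unique[symmetric]) (simp flip: slice_mult[OF assms])
qed (simp add: slice_def)

text \<open>The square root and the exponential both lie in the slice of \<open>u\<close>, so the
  whole kernel is the image of a single complex number, whose modulus and phase can be treated
  separately.\<close>

lemma lct_kernel_eq: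
  assumes "u * u = -1"
  shows "lct_kernel u A x \<omega> = slice u (inverse (csqrt (of_real (2 * pi * A $ 1 $ 2))) *
    cis ((A $ 1 $ 1 / A $ 1 $ 2 * x\<^sup>2 - 2 / A $ 1 $ 2 * x * \<omega> + A $ 2 $ 2 / A $ 1 $ 2 * \<omega>\<^sup>2 -
        pi / 2) / 2))"
proof -
  have half: "inverse (2::quat) = of_real (1 / 2)"
    by simp
  have comm: "of_real r * u = u * of_real r" for r
    by (simp add: of_real_def)
  have "u / 2 * of_real t = slice u (\<i> * of_real (t / 2))" for t
  proof -
    have "u / 2 * of_real t = u * of_real (1 / 2 * t)"
      unfolding divide_inverse[of u] half mult.assoc of_real_mult ..
    also have "\<dots> = slice u (\<i> * of_real (t / 2))"
      unfolding slice_def comm[symmetric] by simp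
    finally show ?thesis .
  qed
  then show ?thesis
    unfolding lct_kernel_def Let_def slice_mult[OF assms] slice_inverse[OF assms] cis_conv_exp
        slice_exp[OF assms]
      divide_inverse[of 1] mult_1_left by metis
qed

section \<open>Continuity of translation in \<open>L\<^sup>1\<close>\<close>

lemma integrable_lborel_translate:
  fixes f :: "'a::euclidean_space \<Rightarrow> 'b::{banach, second_countable_topology}"
  assumes "integrable lborel f"
  shows "integrable lborel (\<lambda>x. f (x + z))"
proof -
  have "integrable (distr lborel borel ((+) z)) f"
    using assms by (simp add: lborel_distr_plus)
  then show ?thesis
    by (subst (asm) integrable_distr_eq) (use assms in \<open>auto simp: add.commute\<close>)
qed

lemma integral_lborel_translate:
  fixes f :: "'a::euclidean_space \<Rightarrow> 'b::{banach, second_countable_topology}"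
  assumes [measurable]: "f \<in> borel_measurable borel"
  shows "(\<integral>x. f (x + z) \<partial>lborel) = integral\<^sup>L lborel f"
proof -
  have "integral\<^sup>L (distr lborel borel ((+) z)) f = integral\<^sup>L lborel f"
    by (simp add: lborel_distr_plus)
  then show ?thesis
    by (subst (asm) integral_distr) (auto simp: add.commute)
qed

lemma nn_integral_lborel_translate:
  fixes f :: "'a::euclidean_space \<Rightarrow> ennreal"
  assumes [measurable]: "f \<in> borel_measurable borel"
  shows "(\<integral>\<^sup>+x. f (x + z) \<partial>lborel) = integral\<^sup>N lborel f"
proof -
  have "integral\<^sup>N (distr lborel borel ((+) z)) f = integral\<^sup>N lborel f"
    by (simp add: lborel_distr_plus)
  then show ?thesis
    by (subst (asm) nn_integral_distr) (auto simp: add.commute)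
qed

lemma nn_integral_lborel_scale:
  fixes f :: "'a::euclidean_space \<Rightarrow> ennreal"
  assumes [measurable]: "f \<in> borel_measurable borel" and "c \<noteq> 0"
  shows "integral\<^sup>N lborel f = \<bar>c\<bar> ^ DIM('a) * (\<integral>\<^sup>+x. f (c *\<^sub>R x) \<partial>lborel)"
  by (subst lborel_affine[OF assms(2), of 0])
     (simp add: nn_integral_density nn_integral_distr nn_integral_cmult ennreal_power)

lemma nn_integral_lborel_reflect:
  fixes f :: "'a::euclidean_space \<Rightarrow> ennreal"
  assumes [measurable]: "f \<in> borel_measurable borel"
  shows "(\<integral>\<^sup>+x. f (z - x) \<partial>lborel) = integral\<^sup>N lborel f"
proof -
  have "integral\<^sup>N lborel f = (\<integral>\<^sup>+x. f (x + z) \<partial>lborel)"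
    by (rule nn_integral_lborel_translate[symmetric]) simp
  also have "\<dots> = (\<integral>\<^sup>+x. f (-1 *\<^sub>R x + z) \<partial>lborel)"
    using nn_integral_lborel_scale[of "\<lambda>x. f (x + z)" "-1"] by simp
  finally show ?thesis by simp
qed

section \<open>The L1 modulus of continuity\<close>

definition L1_modulus ::
  "('a::euclidean_space \<Rightarrow> 'b::{banach, second_countable_topology}) \<Rightarrow> 'a \<Rightarrow> real" where
  "L1_modulus f z = (\<integral>x. norm (f (x + z) - f x) \<partial>lborel)"

lemma L1_modulus_nonneg: "0 \<le> L1_modulus f z"
  by (simp add: L1_modulus_def)

lemma L1_modulus_add:
  assumes "integrable lborel f" "integrable lborel g"
  shows "L1_modulus (\<lambda>x. f x + g x) z \<le> L1_modulus f z + L1_modulus g z"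
proof -
  note int = assms integrable_lborel_translate[OF assms(1)] integrable_lborel_translate[OF assms(2)]
  have "L1_modulus (\<lambda>x. f x + g x) z \<le> (\<integral>x. norm (f (x + z) - f x) + norm (g (x + z) - g x) \<partial>lborel)"
    unfolding L1_modulus_def
    by (intro integral_mono) (use int in \<open>auto simp: norm_diff_triangle_ineq\<close>)
  also have "\<dots> = L1_modulus f z + L1_modulus g z"
    unfolding L1_modulus_def using int by (intro Bochner_Integration.integral_add) auto
  finally show ?thesis .
qed

text \<open>The bound is uniform in \<open>z\<close>. It controls the error of an L1 approximation
  and later supplies the dominating function for the mollifier limit.\<close>

lemma L1_modulus_le:
  assumes "integrable lborel f"
  shows "L1_modulus f z \<le> 2 * (\<integral>x. norm (f x) \<partial>lborel)"
proof -
  note int = assms integrable_lborel_translate[OF assms]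
  have "L1_modulus f z \<le> (\<integral>x. norm (f (x + z)) + norm (f x) \<partial>lborel)"
    unfolding L1_modulus_def
    by (intro integral_mono) (use int in \<open>auto simp: norm_triangle_ineq4\<close>)
  also have "\<dots> = (\<integral>x. norm (f (x + z)) \<partial>lborel) + (\<integral>x. norm (f x) \<partial>lborel)"
    using int by (intro Bochner_Integration.integral_add) auto
  also have "(\<integral>x. norm (f (x + z)) \<partial>lborel) = (\<integral>x. norm (f x) \<partial>lborel)"
    using assms by (intro integral_lborel_translate[of "\<lambda>x. norm (f x)"]) auto
  finally show ?thesis by simp
qed

text \<open>Continuity of translation survives L1 limits: splitting \<open>f = g + (f - g)\<close>,
  the second summand contributes at most twice its L1 norm, for every translation.\<close>

lemma L1_modulus_tendsto_approx:
  fixes f :: "'a::euclidean_space \<Rightarrow> 'b::{banach, second_countable_topology}"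
  assumes f: "integrable lborel f"
    and approx: "\<And>e. e > 0 \<Longrightarrow> \<exists>g. integrable lborel g \<and> (L1_modulus g \<longlongrightarrow> 0) (nhds 0) \<and>
                    (\<integral>x. norm (f x - g x) \<partial>lborel) < e"
  shows "(L1_modulus f \<longlongrightarrow> 0) (nhds 0)"
proof (rule tendstoI)
  fix e :: real assume e: "e > 0"
  obtain g where g: "integrable lborel g" "(L1_modulus g \<longlongrightarrow> 0) (nhds 0)"
     "(\<integral>x. norm (f x - g x) \<partial>lborel) < e / 4"
    \<comment> \<open>A quarter, because the error enters doubled and so uses up half of
      \<open>e\<close>.\<close>
    using approx[of "e / 4"] e by auto
  have "\<forall>\<^sub>F z in nhds 0. dist (L1_modulus g z) 0 < e / 2"
    using tendstoD[OF g(2), of "e/2"] e by simp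
  then show "\<forall>\<^sub>F z in nhds 0. dist (L1_modulus f z) 0 < e"
  proof eventually_elim
    case (elim z)
    have "L1_modulus (\<lambda>x. g x + (f x - g x)) z \<le> L1_modulus g z + L1_modulus (\<lambda>x. f x - g x) z"
      by (intro L1_modulus_add) (use f g in auto)
    moreover have "L1_modulus (\<lambda>x. f x - g x) z \<le> 2 * (\<integral>x. norm (f x - g x) \<partial>lborel)"
      by (intro L1_modulus_le) (use f g in auto)
    ultimately show ?case
      using elim g(3) L1_modulus_nonneg[of f z] L1_modulus_nonneg[of g z] by (simp add: dist_real_def)
  qed
qed

text \<open>Since \<open>\<bar>a - b\<bar> = 2 * max 0 (a - b) - (a - b)\<close> and the difference has integral zero, only the
  points outside the compact set matter, where the translated indicator vanishes eventually.\<close>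

lemma L1_modulus_tendsto_compact:
  fixes K :: "'a::euclidean_space set" and c :: "'b::{banach, second_countable_topology}"
  assumes K: "compact K"
  shows "(L1_modulus (\<lambda>x. indicator K x *\<^sub>R c) \<longlongrightarrow> 0) (nhds 0)"
proof -
  have [measurable]: "K \<in> sets borel"
    using K by (simp add: borel_closed compact_imp_closed)
  have intK: "integrable lborel (indicator K :: 'a \<Rightarrow> real)"
    using emeasure_compact_finite[OF K] by (intro integrable_real_indicator) auto
  note intKz = integrable_lborel_translate[OF intK]
  let ?p = "\<lambda>z x. max 0 (indicator K (x + z) - indicator K x :: real)"
  have eq: "L1_modulus (\<lambda>x. indicator K x *\<^sub>R c) z = 2 * norm c * (\<integral>x. ?p z x \<partial>lborel)" for z
  proof -
    have "L1_modulus (\<lambda>x. indicator K x *\<^sub>R c) z =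
        (\<integral>x. norm c * (2 * ?p z x - (indicator K (x + z) - indicator K x)) \<partial>lborel)"
      unfolding L1_modulus_def by (intro Bochner_Integration.integral_cong) (auto simp: indicator_def)
    also have "\<dots> = norm c * (2 * (\<integral>x. ?p z x \<partial>lborel) -
         ((\<integral>x. indicator K (x + z) \<partial>lborel) - (\<integral>x. indicator K x \<partial>lborel)))"
      using intK intKz[of z]
      by (simp del: integral_indicator Bochner_Integration.integral_indicator)
    also have "(\<integral>x. indicator K (x + z) \<partial>lborel) = (\<integral>x. indicator K x \<partial>(lborel::'a measure) :: real)"
      by (rule integral_lborel_translate) simp
    finally show ?thesis by simp
  qed
  obtain R where R: "\<And>x. x \<in> K \<Longrightarrow> norm x \<le> R"
    using compact_imp_bounded[OF K] unfolding bounded_iff by auto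
  have "((\<lambda>z. \<integral>x. ?p z x \<partial>lborel) \<longlongrightarrow> (\<integral>x. 0 \<partial>(lborel::'a measure))) (at 0)"
  proof (rule tendsto_at_iff_sequentially[THEN iffD2], intro allI impI)
    fix X :: "nat \<Rightarrow> 'a" assume X: "\<forall>i. X i \<in> UNIV - {0}" "X \<longlonglongrightarrow> 0"
    \<comment> \<open>Translations shorter than 1 keep every integrand inside the ball of radius
      \<open>R + 1\<close>, whose indicator is the dominating function.\<close>
    obtain N where N: "\<And>n. n \<ge> N \<Longrightarrow> norm (X n) < 1"
      using X(2) LIMSEQ_D[of X 0 1] by auto
    have "(\<lambda>n. \<integral>x. ?p (X (n + N)) x \<partial>lborel) \<longlonglongrightarrow> (\<integral>x. 0 \<partial>(lborel::'a measure))"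
    proof (rule integral_dominated_convergence[where w = "indicator (cball 0 (R + 1))"])
      show "integrable lborel (indicator (cball (0::'a) (R + 1)) :: 'a \<Rightarrow> real)"
        by (intro integrable_real_indicator) (auto intro:
            emeasure_compact_finite[unfolded infinity_ennreal_def])
      show "AE x in lborel. norm (?p (X (n + N)) x) \<le> indicator (cball 0 (R + 1)) x" for n
      proof (rule AE_I2)
        fix x :: 'a
        have "norm x \<le> R + 1" if "x + X (n + N) \<in> K"
        proof -
          have "norm x \<le> norm (x + X (n + N)) + norm (X (n + N))"
            by (metis add_diff_cancel_right' norm_triangle_ineq4)
          then show ?thesis using R[OF that] N[of "n + N"] by simp
        qed
        then show "norm (?p (X (n + N)) x) \<le> indicator (cball 0 (R + 1)) x"
          by (auto simp: indicator_def)
      qed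
      show "AE x in lborel. (\<lambda>n. ?p (X (n + N)) x) \<longlonglongrightarrow> 0"
      proof (rule AE_I2)
        fix x :: 'a
        show "(\<lambda>n. ?p (X (n + N)) x) \<longlonglongrightarrow> 0"
        proof (cases "x \<in> K")
          case True
          then show ?thesis by (simp add: indicator_def)
        next
          case False
          have "(\<lambda>n. x + X (n + N)) \<longlonglongrightarrow> x + 0"
            by (intro tendsto_intros LIMSEQ_ignore_initial_segment X)
          moreover have "open (- K)" using K compact_imp_closed by auto
          ultimately have "\<forall>\<^sub>F n in sequentially. x + X (n + N) \<in> - K"
            using False topological_tendstoD by fastforce
          then show ?thesis
            by (rule tendsto_eventually[OF eventually_mono]) (auto simp: indicator_def)
        qed
      qed
    qed auto
    then show "((\<lambda>z. \<integral>x. ?p z x \<partial>lborel) \<circ> X) \<longlonglongrightarrow> (\<integral>x. 0 \<partial>(lborel::'a measure))"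
      unfolding o_def by (rule LIMSEQ_offset)
  qed
  then have "((\<lambda>z. 2 * norm c * (\<integral>x. ?p z x \<partial>lborel)) \<longlongrightarrow> 2 * norm c *
      (\<integral>x. 0 \<partial>(lborel::'a measure))) (at 0)"
    by (intro tendsto_intros)
  then have "(L1_modulus (\<lambda>x. indicator K x *\<^sub>R c) \<longlongrightarrow> 0) (at 0)"
    by (simp add: fun_eq_iff[THEN iffD2, OF allI, OF eq])
  \<comment> \<open>The value at 0 turns the punctured limit into one along
    \<open>nhds 0\<close>.\<close>
  moreover have "L1_modulus (\<lambda>x. indicator K x *\<^sub>R c) 0 = 0"
    by (simp add: L1_modulus_def)
  ultimately show ?thesis
    unfolding tendsto_nhds_iff by blast
qed

text \<open>Induction over integrable functions: indicators are approximated by compact sets from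
  inside, sums use subadditivity, and dominated limits are L1 limits. The filter is
  \<open>nhds 0\<close> so that the limit can be composed with sequences that take the value
  0.\<close>

lemma L1_modulus_tendsto_0:
  fixes f :: "'a::euclidean_space \<Rightarrow> 'b::{banach, second_countable_topology}"
  assumes "integrable lborel f"
  shows "(L1_modulus f \<longlongrightarrow> 0) (nhds 0)"
  using assms
proof (induction rule: integrable_induct)
  case (base A c)
  have [measurable]: "A \<in> sets borel" using base by simp
  have Aint: "integrable lborel (indicator A :: 'a \<Rightarrow> real)"
    using base by (intro integrable_real_indicator) auto
  show ?case
  proof (rule L1_modulus_tendsto_approx)
    show "integrable lborel (\<lambda>x. indicator A x *\<^sub>R c)"
      using Aint by simp
    fix e :: real assume e: "e > 0"
    \<comment> \<open>Adding 1 avoids division by zero and makes \<open>norm c * d < e\<close>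
      strict.\<close>
    define d where "d = e / (norm c + 1)"
    have d: "d > 0" using e by (simp add: d_def add_nonneg_pos)
    obtain K where K: "compact K" "K \<subseteq> A" "measure lborel (A - K) < d"
    proof -
      \<comment> \<open>Inner regularity gives a closed set only. Cutting it with growing balls
        makes it compact, and continuity from above keeps the defect below \<open>d\<close>. The
        half leaves room for the non-strict bound on the real-valued measure.\<close>
      obtain T where T: "closed T" "T \<subseteq> A" "A - T \<in> lmeasurable"
        "emeasure lebesgue (A - T) < ennreal (d / 2)"
        using sets_lebesgue_inner_closed[of A "d / 2"] d by auto
      let ?K = "\<lambda>n::nat. T \<inter> cball 0 (real n)"
      have [measurable]: "T \<in> sets borel" using T by simp
      have "(\<lambda>n. measure lborel (A - ?K n)) \<longlonglongrightarrow> measure lborel (\<Inter>n. A - ?K n)"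
      proof (rule Lim_measure_decseq)
        show "range (\<lambda>n. A - ?K n) \<subseteq> sets lborel" by auto
        show "decseq (\<lambda>n. A - ?K n)" by (auto simp: decseq_def)
        show "emeasure lborel (A - ?K i) \<noteq> \<infinity>" for i
          using base emeasure_mono[of "A - ?K i" A lborel] by auto
      qed
      moreover have "(\<Inter>n. A - ?K n) = A - T"
        by (auto simp: real_arch_simple)
      moreover have "measure lborel (A - T) < d"
      proof -
        have "emeasure lborel (A - T) < ennreal (d / 2)" using T(4) by simp
        then have "measure lborel (A - T) \<le> d / 2"
          unfolding measure_def using d by (intro enn2real_leI) auto
        then show ?thesis using d by simp
      qed
      ultimately have "\<forall>\<^sub>F n in sequentially. measure lborel (A - ?K n) < d"
        by (auto dest!: order_tendstoD(2)[of _ _ _ d])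
      then obtain n where "measure lborel (A - ?K n) < d"
        using eventually_happens by force
      then show ?thesis
        using that[of "?K n"] T(1,2) closed_Int_compact[OF T(1) compact_cball] by blast
    qed
    have [measurable]: "K \<in> sets borel" using K by (simp add: borel_closed compact_imp_closed)
    have "(\<integral>x. norm (indicator A x *\<^sub>R c - indicator K x *\<^sub>R c) \<partial>lborel) =
        (\<integral>x. norm c * indicator (A - K) x \<partial>lborel)"
      by (intro Bochner_Integration.integral_cong) (use K in \<open>auto simp: indicator_def\<close>)
    also have "\<dots> = norm c * measure lborel (A - K)" by simp
    also have "\<dots> \<le> norm c * d" using K by (intro mult_left_mono) auto
    also have "\<dots> < (norm c + 1) * d" using d by simp
    also have "\<dots> = e" using norm_ge_zero[of c] by (simp add: d_def del: norm_ge_zero)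
    finally show "\<exists>g. integrable lborel g \<and> (L1_modulus g \<longlongrightarrow> 0) (nhds 0) \<and>
                    (\<integral>x. norm (indicator A x *\<^sub>R c - g x) \<partial>lborel) < e"
      using L1_modulus_tendsto_compact[OF K(1), of c] K(1)
      by (intro exI[of _ "\<lambda>x. indicator K x *\<^sub>R c"])
         (auto intro!: integrable_scaleR_left integrable_real_indicator intro:
             emeasure_compact_finite[unfolded infinity_ennreal_def])
  qed
next
  case (add f g)
  have "((\<lambda>z. L1_modulus f z + L1_modulus g z) \<longlongrightarrow> 0 + 0) (nhds 0)"
    by (intro tendsto_add add)
  then have lim: "((\<lambda>z. L1_modulus f z + L1_modulus g z) \<longlongrightarrow> 0) (nhds 0)"
    by simp
  show ?case
  proof (rule tendsto_sandwich[OF _ _ tendsto_const lim])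
    show "\<forall>\<^sub>F z in nhds 0. 0 \<le> L1_modulus (\<lambda>x. f x + g x) z"
      by (simp add: L1_modulus_nonneg)
    show "\<forall>\<^sub>F z in nhds 0. L1_modulus (\<lambda>x. f x + g x) z \<le> L1_modulus f z + L1_modulus g z"
      using L1_modulus_add[OF add(1,2)] by simp
  qed
next
  case (lim f s)
  show ?case
  proof (rule L1_modulus_tendsto_approx[OF lim.hyps(4)])
    fix e :: real assume e: "e > 0"
    have "(\<lambda>i. \<integral>x. norm (f x - s i x) \<partial>lborel) \<longlonglongrightarrow> (\<integral>x. 0 \<partial>(lborel::'a measure))"
    \<comment> \<open>The induction rule provides \<open>norm (s i x) \<le> 2 * norm (f x)\<close>;
      the third copy comes from \<open>f\<close> itself.\<close>
    proof (rule integral_dominated_convergence[where w = "\<lambda>x. 3 * norm (f x)"])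
      show "AE x in lborel. (\<lambda>i. norm (f x - s i x)) \<longlonglongrightarrow> 0"
      proof (rule AE_I2)
        fix x :: 'a
        have "(\<lambda>i. norm (f x - s i x)) \<longlonglongrightarrow> norm (f x - f x)"
          using lim.hyps(2)[of x] by (intro tendsto_intros) simp
        then show "(\<lambda>i. norm (f x - s i x)) \<longlonglongrightarrow> 0" by simp
      qed
      show "AE x in lborel. norm (norm (f x - s i x)) \<le> 3 * norm (f x)" for i
      proof (rule AE_I2)
        fix x :: 'a
        show "norm (norm (f x - s i x)) \<le> 3 * norm (f x)"
          using lim.hyps(3)[of x i] norm_triangle_ineq4[of "f x" "s i x"] by simp
      qed
    qed (use lim.hyps in auto)
    then have "\<forall>\<^sub>F i in sequentially. (\<integral>x. norm (f x - s i x) \<partial>lborel) < e"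
      using e by (auto dest!: order_tendstoD(2)[of _ _ _ e])
    then obtain i where "(\<integral>x. norm (f x - s i x) \<partial>lborel) < e"
      using eventually_happens by force
    then show "\<exists>g. integrable lborel g \<and> (L1_modulus g \<longlongrightarrow> 0) (nhds 0) \<and>
                    (\<integral>x. norm (f x - g x) \<partial>lborel) < e"
      using lim.hyps(1) lim.IH by blast
  qed
qed

section \<open>Gram form of the energy of an integral\<close>

text \<open>The squared norm of an integral is a double integral of inner products, and Fubini moves
  the integration over \<open>w\<close> inside. The product form of the bound makes the triple
  integral absolutely convergent, with total at most the square of the integral of \<open>h\<close>.
  The lemma serves both the frequency side and the mollified side of the Plancherel
  estimate.\<close>

lemma gram_integral:
  fixes F :: "'a \<Rightarrow> 'c \<Rightarrow> 'b::euclidean_space" and h :: "'a \<Rightarrow> real"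
  assumes "sigma_finite_measure M" "sigma_finite_measure N"
    and F [measurable]: "case_prod F \<in> borel_measurable (M \<Otimes>\<^sub>M N)"
    and intF: "\<And>w. w \<in> space N \<Longrightarrow> integrable M (\<lambda>x. F x w)"
    and h: "integrable M h" "\<And>x. 0 \<le> h x"
    and bound: "\<And>x x'. x \<in> space M \<Longrightarrow> x' \<in> space M \<Longrightarrow>
       (\<integral>\<^sup>+w. ennreal (norm (F x w) * norm (F x' w)) \<partial>N) \<le> ennreal (h x * h x')"
  shows gram_integrable: "integrable N (\<lambda>w. (norm (\<integral>x. F x w \<partial>M))\<^sup>2)"
    and gram_integral_eq: "(\<integral>w. (norm (\<integral>x. F x w \<partial>M))\<^sup>2 \<partial>N) =
       (\<integral>p. (\<integral>w. F (fst p) w \<bullet> F (snd p) w \<partial>N) \<partial>(M \<Otimes>\<^sub>M M))"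
proof -
  interpret M: sigma_finite_measure M by fact
  interpret N: sigma_finite_measure N by fact
  interpret MM: pair_sigma_finite M M ..
  interpret P: sigma_finite_measure "M \<Otimes>\<^sub>M M" ..
  interpret MMN: pair_sigma_finite "M \<Otimes>\<^sub>M M" N ..
  have [measurable]: "h \<in> borel_measurable M" using h by auto
  have m1 [measurable]: "(\<lambda>x. F (fst (fst x)) (snd x)) \<in> borel_measurable ((M \<Otimes>\<^sub>M M) \<Otimes>\<^sub>M N)"
    using measurable_compose[OF _ F, of "\<lambda>x. (fst (fst x), snd x)" "(M \<Otimes>\<^sub>M M) \<Otimes>\<^sub>M N"] by simp
  have m2 [measurable]: "(\<lambda>x. F (snd (fst x)) (snd x)) \<in> borel_measurable ((M \<Otimes>\<^sub>M M) \<Otimes>\<^sub>M N)"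
    using measurable_compose[OF _ F, of "\<lambda>x. (snd (fst x), snd x)" "(M \<Otimes>\<^sub>M M) \<Otimes>\<^sub>M N"] by simp
  define G where "G = (\<lambda>p w. F (fst p) w \<bullet> F (snd p) w)"
  have G_meas [measurable]: "case_prod G \<in> borel_measurable ((M \<Otimes>\<^sub>M M) \<Otimes>\<^sub>M N)"
    unfolding G_def case_prod_beta' by measurable
  have G: "integrable ((M \<Otimes>\<^sub>M M) \<Otimes>\<^sub>M N) (case_prod G)"
  proof (rule integrableI_bounded)
    have "(\<integral>\<^sup>+q. norm (case_prod G q) \<partial>((M \<Otimes>\<^sub>M M) \<Otimes>\<^sub>M N)) = (\<integral>\<^sup>+p. \<integral>\<^sup>+w. norm (G p w) \<partial>N \<partial>(M \<Otimes>\<^sub>M M))"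
      by (subst N.nn_integral_fst[symmetric]) auto
    also have "\<dots> \<le> (\<integral>\<^sup>+p. ennreal (h (fst p) * h (snd p)) \<partial>(M \<Otimes>\<^sub>M M))"
    proof (rule nn_integral_mono)
      fix p assume p: "p \<in> space (M \<Otimes>\<^sub>M M)"
      have "(\<integral>\<^sup>+w. norm (G p w) \<partial>N) \<le> (\<integral>\<^sup>+w. ennreal (norm (F (fst p) w) * norm (F (snd p) w)) \<partial>N)"
        by (intro nn_integral_mono ennreal_leI) (simp add: G_def Cauchy_Schwarz_ineq2)
      also have "\<dots> \<le> ennreal (h (fst p) * h (snd p))"
        using p by (intro bound) (auto simp: space_pair_measure)
      finally show "(\<integral>\<^sup>+w. norm (G p w) \<partial>N) \<le> ennreal (h (fst p) * h (snd p))" .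
    qed
    also have "\<dots> = (\<integral>\<^sup>+x. \<integral>\<^sup>+y. ennreal (h x) * ennreal (h y) \<partial>M \<partial>M)"
      by (subst M.nn_integral_fst[symmetric]) (auto simp: ennreal_mult h)
    also have "\<dots> = (\<integral>\<^sup>+x. ennreal (h x) \<partial>M) * (\<integral>\<^sup>+x. ennreal (h x) \<partial>M)"
      by (simp add: nn_integral_cmult nn_integral_multc)
    also have "\<dots> < \<infinity>"
      using h by (simp add: nn_integral_eq_integral ennreal_mult_less_top)
    finally show "(\<integral>\<^sup>+q. norm (case_prod G q) \<partial>((M \<Otimes>\<^sub>M M) \<Otimes>\<^sub>M N)) < \<infinity>" .
  qed fact
  \<comment> \<open>Fubini guarantees integrability of \<open>G\<close> in the pair variable for
    almost every \<open>w\<close> only, hence the equality almost everywhere.\<close>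
  have ae: "AE w in N. (\<integral>p. G p w \<partial>(M \<Otimes>\<^sub>M M)) = (norm (\<integral>x. F x w \<partial>M))\<^sup>2"
    using MMN.AE_integrable_snd[OF G] AE_space
  proof eventually_elim
    case (elim w)
    have "(\<integral>p. G p w \<partial>(M \<Otimes>\<^sub>M M)) = (\<integral>x. (\<integral>y. G (x, y) w \<partial>M) \<partial>M)"
      by (rule MM.integral_fst'[OF elim(1), symmetric])
    also have "\<dots> = (\<integral>x. F x w \<bullet> (\<integral>y. F y w \<partial>M) \<partial>M)"
      using intF[OF elim(2)] by (simp add: G_def)
    also have "\<dots> = (\<integral>x. F x w \<partial>M) \<bullet> (\<integral>y. F y w \<partial>M)"
      using intF[OF elim(2)] by simp
    finally show ?case by (simp add: power2_norm_eq_inner)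
  qed
  have mN: "(\<lambda>w. (norm (\<integral>x. F x w \<partial>M))\<^sup>2) \<in> borel_measurable N"
  proof -
    have "(\<lambda>q. F (snd q) (fst q)) \<in> borel_measurable (N \<Otimes>\<^sub>M M)"
      using measurable_compose[OF _ F, of "\<lambda>x. (snd x, fst x)" "N \<Otimes>\<^sub>M M"] by simp
    then have [measurable]: "(\<lambda>(w, x). F x w) \<in> borel_measurable (N \<Otimes>\<^sub>M M)"
      by (simp add: case_prod_beta')
    show ?thesis by measurable
  qed
  have mG: "(\<lambda>w. \<integral>p. G p w \<partial>(M \<Otimes>\<^sub>M M)) \<in> borel_measurable N"
    using MMN.integrable_snd[OF G] by auto
  show "integrable N (\<lambda>w. (norm (\<integral>x. F x w \<partial>M))\<^sup>2)"
    using MMN.integrable_snd[OF G] integrable_cong_AE[OF mG mN ae] by simp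
  have "(\<integral>w. (norm (\<integral>x. F x w \<partial>M))\<^sup>2 \<partial>N) = (\<integral>w. (\<integral>p. G p w \<partial>(M \<Otimes>\<^sub>M M)) \<partial>N)"
    using integral_cong_AE[OF mG mN ae] by simp
  also have "\<dots> = (\<integral>p. (\<integral>w. G p w \<partial>N) \<partial>(M \<Otimes>\<^sub>M M))"
    by (rule MMN.Fubini_integral[OF G])
  finally show "(\<integral>w. (norm (\<integral>x. F x w \<partial>M))\<^sup>2 \<partial>N) =
       (\<integral>p. (\<integral>w. F (fst p) w \<bullet> F (snd p) w \<partial>N) \<partial>(M \<Otimes>\<^sub>M M))"
    by (simp add: G_def)
qed

section \<open>Gaussian mollifiers on the plane\<close>

text \<open>Minkowski's integral inequality. As \<open>\<rho>\<close> has mass one,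
  \<open>H t\<close> is its own average, so the difference is the \<open>\<rho>\<close>-average of
  \<open>H (t + z) - H t\<close>; Tonelli then integrates over \<open>t\<close> first. Boundedness
  of \<open>\<rho>\<close> makes the averages exist for every \<open>t\<close>. With
  \<open>x - t\<close> as argument the substitution is a mere translation.\<close>

lemma mollifier_L1_bound:
  fixes H :: "'a::euclidean_space \<Rightarrow> 'b::{banach, second_countable_topology}" and \<rho> :: "'a \<Rightarrow> real"
  assumes H: "integrable lborel H"
    and \<rho> [measurable]: "\<rho> \<in> borel_measurable borel" and "\<And>z. 0 \<le> \<rho> z" "\<And>z. \<rho> z \<le> B"
    and \<rho>1: "(\<integral>\<^sup>+z. ennreal (\<rho> z) \<partial>lborel) = 1"
  shows "(\<integral>\<^sup>+t. norm ((\<integral>x. \<rho> (x - t) *\<^sub>R H x \<partial>lborel) - H t) \<partial>lborel)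
    \<le> (\<integral>\<^sup>+z. ennreal (\<rho> z * L1_modulus H z) \<partial>lborel)"
proof -
  have [measurable]: "H \<in> borel_measurable borel" using H by auto
  have int\<rho>: "integrable lborel \<rho>"
    by (rule integrableI_bounded) (use assms in auto)
  have int1: "integrable lborel (\<lambda>z. \<rho> z *\<^sub>R H (z + t))" for t
  proof (rule Bochner_Integration.integrable_bound)
    show "integrable lborel (\<lambda>z. B * norm (H (z + t)))"
      using integrable_lborel_translate[OF H, of t] by simp
    show "AE z in lborel. norm (\<rho> z *\<^sub>R H (z + t)) \<le> norm (B * norm (H (z + t)))"
    proof (rule AE_I2)
      fix z
      have "\<bar>\<rho> z\<bar> \<le> \<bar>B\<bar>" using assms(3,4)[of z] by linarith
      then show "norm (\<rho> z *\<^sub>R H (z + t)) \<le> norm (B * norm (H (z + t)))"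
        by (simp add: abs_mult mult_right_mono)
    qed
  qed simp
  have conv: "(\<integral>x. \<rho> (x - t) *\<^sub>R H x \<partial>lborel) = (\<integral>z. \<rho> z *\<^sub>R H (z + t) \<partial>lborel)" for t
    using integral_lborel_translate[of "\<lambda>x. \<rho> (x - t) *\<^sub>R H x" t] by simp
  have const: "H t = (\<integral>z. \<rho> z *\<^sub>R H t \<partial>lborel)" for t
  proof -
    have "(\<integral>z. \<rho> z \<partial>lborel) = 1"
      using nn_integral_eq_integral[OF int\<rho>] \<rho>1 assms(3) by simp
    then show ?thesis using int\<rho> by simp
  qed
  have "(\<integral>\<^sup>+t. norm ((\<integral>x. \<rho> (x - t) *\<^sub>R H x \<partial>lborel) - H t) \<partial>lborel)
     \<le> (\<integral>\<^sup>+t. \<integral>\<^sup>+z. ennreal (\<rho> z * norm (H (t + z) - H t)) \<partial>lborel \<partial>lborel)"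
  proof (rule nn_integral_mono)
    fix t
    have "(\<integral>x. \<rho> (x - t) *\<^sub>R H x \<partial>lborel) - H t = (\<integral>z. \<rho> z *\<^sub>R H (z + t) - \<rho> z *\<^sub>R H t \<partial>lborel)"
      by (subst Bochner_Integration.integral_diff[OF int1])
         (use int\<rho> const[of t] in \<open>auto simp: conv\<close>)
    also have "\<dots> = (\<integral>z. \<rho> z *\<^sub>R (H (t + z) - H t) \<partial>lborel)"
      by (simp add: scaleR_diff_right add.commute)
    also have "norm \<dots> \<le> (\<integral>\<^sup>+z. norm (\<rho> z *\<^sub>R (H (t + z) - H t)) \<partial>lborel)"
    proof (rule integral_norm_bound_ennreal)
      have "integrable lborel (\<lambda>z. \<rho> z *\<^sub>R H (z + t) - \<rho> z *\<^sub>R H t)"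
        using int1 int\<rho> by auto
      then show "integrable lborel (\<lambda>z. \<rho> z *\<^sub>R (H (t + z) - H t))"
        by (simp add: scaleR_diff_right add.commute)
    qed
    finally show "ennreal (norm ((\<integral>x. \<rho> (x - t) *\<^sub>R H x \<partial>lborel) - H t))
       \<le> (\<integral>\<^sup>+z. ennreal (\<rho> z * norm (H (t + z) - H t)) \<partial>lborel)"
      using assms(3) by simp
  qed
  also have "\<dots> = (\<integral>\<^sup>+z. \<integral>\<^sup>+t. ennreal (\<rho> z * norm (H (t + z) - H t)) \<partial>lborel \<partial>lborel)"
    by (rule lborel_pair.Fubini') measurable
  also have "\<dots> = (\<integral>\<^sup>+z. ennreal (\<rho> z * L1_modulus H z) \<partial>lborel)"
  proof (rule nn_integral_cong)
    fix z
    have "(\<integral>\<^sup>+t. ennreal (\<rho> z * norm (H (t + z) - H t)) \<partial>lborel) =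
       ennreal (\<rho> z) * (\<integral>\<^sup>+t. ennreal (norm (H (t + z) - H t)) \<partial>lborel)"
      using assms(3) by (simp add: ennreal_mult nn_integral_cmult)
    also have "(\<integral>\<^sup>+t. ennreal (norm (H (t + z) - H t)) \<partial>lborel) = ennreal (L1_modulus H z)"
      unfolding L1_modulus_def using H integrable_lborel_translate[OF H, of z]
      by (intro nn_integral_eq_integral) auto
    finally show "(\<integral>\<^sup>+t. ennreal (\<rho> z * norm (H (t + z) - H t)) \<partial>lborel) =
        ennreal (\<rho> z * L1_modulus H z)"
      using assms(3) by (simp add: ennreal_mult L1_modulus_nonneg)
  qed
  finally show ?thesis .
qed

text \<open>Scaling moves the dilation from \<open>\<rho>\<close> into the argument of the modulus,
  where \<open>z / Suc n\<close> tends to 0. Dominated convergence applies because the modulus is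
  bounded uniformly in the translation.\<close>

lemma mollifier_modulus_tendsto_0:
  fixes H :: "'a::euclidean_space \<Rightarrow> 'b::{banach, second_countable_topology}" and \<rho> :: "'a \<Rightarrow> real"
  assumes H: "integrable lborel H"
    and \<rho> [measurable]: "\<rho> \<in> borel_measurable borel" and "\<And>z. 0 \<le> \<rho> z"
    and \<rho>1: "(\<integral>\<^sup>+z. ennreal (\<rho> z) \<partial>lborel) = 1"
  shows "(\<lambda>n. \<integral>\<^sup>+z. ennreal (real (Suc n) ^ DIM('a) * \<rho> (real (Suc n) *\<^sub>R z) * L1_modulus H z)
      \<partial>lborel) \<longlonglongrightarrow> 0"
proof -
  have [measurable]: "H \<in> borel_measurable borel" using H by auto
  have [measurable]: "L1_modulus H \<in> borel_measurable borel"
    unfolding L1_modulus_def[abs_def] by measurable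
  let ?s = "\<lambda>n. 1 / real (Suc n)"
  have "(\<integral>\<^sup>+z. ennreal (real (Suc n) ^ DIM('a) * \<rho> (real (Suc n) *\<^sub>R z) * L1_modulus H z) \<partial>lborel)
      = (\<integral>\<^sup>+z. ennreal (\<rho> z * L1_modulus H (?s n *\<^sub>R z)) \<partial>lborel)" for n
  proof -
    have "(\<integral>\<^sup>+z. ennreal (real (Suc n) ^ DIM('a) * \<rho> (real (Suc n) *\<^sub>R z) * L1_modulus H z) \<partial>lborel)
      = ennreal (\<bar>?s n\<bar> ^ DIM('a)) * (\<integral>\<^sup>+z. ennreal
          (real (Suc n) ^ DIM('a) * \<rho> (real (Suc n) *\<^sub>R ?s n *\<^sub>R z) * L1_modulus H (?s n *\<^sub>R z))
          \<partial>lborel)"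
      by (subst nn_integral_lborel_scale[of _ "?s n"]) (auto simp: ennreal_power)
    also have "\<dots> = (\<integral>\<^sup>+z. ennreal (\<bar>?s n\<bar> ^ DIM('a)) *
        ennreal (real (Suc n) ^ DIM('a) * \<rho> (real (Suc n) *\<^sub>R ?s n *\<^sub>R z) *
        L1_modulus H (?s n *\<^sub>R z)) \<partial>lborel)"
      by (rule nn_integral_cmult[symmetric]) measurable
    also have "\<dots> = (\<integral>\<^sup>+z. ennreal (\<rho> z * L1_modulus H (?s n *\<^sub>R z)) \<partial>lborel)"
    proof (rule nn_integral_cong)
      fix z
      have "\<bar>?s n\<bar> ^ DIM('a) * real (Suc n) ^ DIM('a) = 1"
        by (simp flip: power_mult_distrib)
      then have "\<bar>?s n\<bar> ^ DIM('a) * (real (Suc n) ^ DIM('a) * \<rho> z * L1_modulus H (?s n *\<^sub>R z)) =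
          \<rho> z * L1_modulus H (?s n *\<^sub>R z)"
        by (metis mult.assoc mult_1)
      moreover have "real (Suc n) *\<^sub>R ?s n *\<^sub>R z = z" by simp
      ultimately show "ennreal (\<bar>?s n\<bar> ^ DIM('a)) *
          ennreal (real (Suc n) ^ DIM('a) * \<rho> (real (Suc n) *\<^sub>R ?s n *\<^sub>R z) * L1_modulus H (?s n *\<^sub>R z))
        = ennreal (\<rho> z * L1_modulus H (?s n *\<^sub>R z))"
        by (metis ennreal_mult' abs_ge_zero zero_le_power)
    qed
    finally show ?thesis .
  qed
  moreover have "(\<lambda>n. \<integral>\<^sup>+z. ennreal (\<rho> z * L1_modulus H (?s n *\<^sub>R z)) \<partial>lborel) \<longlonglongrightarrow>
      (\<integral>\<^sup>+z. 0 \<partial>(lborel :: 'a measure))"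
  proof (rule nn_integral_dominated_convergence[where w =
      "\<lambda>z. ennreal (\<rho> z * (2 * (\<integral>x. norm (H x) \<partial>lborel)))"])
    show "AE z in lborel. ennreal (\<rho> z * L1_modulus H (?s n *\<^sub>R z)) \<le>
        ennreal (\<rho> z * (2 * (\<integral>x. norm (H x) \<partial>lborel)))" for n
      by (intro AE_I2 ennreal_leI mult_left_mono L1_modulus_le assms)
    have "(\<integral>\<^sup>+z. ennreal (\<rho> z * (2 * (\<integral>x. norm (H x) \<partial>lborel))) \<partial>lborel) =
        ennreal (2 * (\<integral>x. norm (H x) \<partial>lborel))"
      using assms(3) by (subst ennreal_mult) (auto simp: nn_integral_multc \<rho>1)
    then show "(\<integral>\<^sup>+z. ennreal (\<rho> z * (2 * (\<integral>x. norm (H x) \<partial>lborel))) \<partial>lborel) < \<infinity>" by simp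
    show "AE z in lborel. (\<lambda>n. ennreal (\<rho> z * L1_modulus H (?s n *\<^sub>R z))) \<longlonglongrightarrow> 0"
    proof (rule AE_I2)
      fix z :: 'a
      have "(\<lambda>n. ?s n *\<^sub>R z) \<longlonglongrightarrow> 0 *\<^sub>R z"
        by (intro tendsto_scaleR tendsto_const)
            (use LIMSEQ_inverse_real_of_nat in \<open>simp add: inverse_eq_divide\<close>)
      then have "(\<lambda>n. L1_modulus H (?s n *\<^sub>R z)) \<longlonglongrightarrow> 0"
        using filterlim_compose[OF L1_modulus_tendsto_0[OF H]] by simp
      then have "(\<lambda>n. \<rho> z * L1_modulus H (?s n *\<^sub>R z)) \<longlonglongrightarrow> \<rho> z * 0"
        by (intro tendsto_mult tendsto_const)
      then have "(\<lambda>n. ennreal (\<rho> z * L1_modulus H (?s n *\<^sub>R z))) \<longlonglongrightarrow> ennreal (\<rho> z * 0)"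
        by (rule tendsto_ennrealI)
      then show "(\<lambda>n. ennreal (\<rho> z * L1_modulus H (?s n *\<^sub>R z))) \<longlonglongrightarrow> 0" by simp
    qed
  qed measurable
  ultimately show ?thesis by simp
qed

text \<open>The isotropic Gaussian, encoded as a product so that its integrals split into
  one-dimensional ones about the normal density.\<close>

definition gauss2 :: "real \<Rightarrow> real \<times> real \<Rightarrow> real" where
  "gauss2 \<sigma> z = normal_density 0 \<sigma> (fst z) * normal_density 0 \<sigma> (snd z)"

lemma gauss2_measurable [measurable]: "gauss2 \<sigma> \<in> borel_measurable borel"
proof -
  have "gauss2 \<sigma> \<in> borel_measurable (borel \<Otimes>\<^sub>M borel)"
    unfolding gauss2_def[abs_def] by measurable
  then show ?thesis by (simp add: borel_prod)
qed

lemma gauss2_nonneg: "0 \<le> gauss2 \<sigma> z"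
  by (simp add: gauss2_def)

lemma gauss2_le: "gauss2 \<sigma> z \<le> 1 / sqrt (2 * pi * \<sigma>\<^sup>2) * (1 / sqrt (2 * pi * \<sigma>\<^sup>2))"
proof -
  have "normal_density 0 \<sigma> x \<le> 1 / sqrt (2 * pi * \<sigma>\<^sup>2)" for x
    unfolding normal_density_def by (intro mult_left_le) auto
  then show ?thesis
    unfolding gauss2_def by (intro mult_mono) auto
qed

lemma nn_integral_lborel_pair_mult:
  fixes f :: "'a::euclidean_space \<Rightarrow> ennreal" and g :: "'b::euclidean_space \<Rightarrow> ennreal"
  assumes [measurable]: "f \<in> borel_measurable borel" "g \<in> borel_measurable borel"
  shows "(\<integral>\<^sup>+z. f (fst z) * g (snd z) \<partial>lborel) = integral\<^sup>N lborel f * integral\<^sup>N lborel g"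
  by (simp add: lborel_prod[symmetric] lborel.nn_integral_fst[symmetric] nn_integral_cmult
      nn_integral_multc)

lemma nn_integral_normal_density: "0 < \<sigma> \<Longrightarrow> (\<integral>\<^sup>+x. ennreal (normal_density \<mu> \<sigma> x) \<partial>lborel) = 1"
  by (subst nn_integral_eq_integral) (auto simp: integral_normal_density)

lemma nn_integral_gauss2: "0 < \<sigma> \<Longrightarrow> (\<integral>\<^sup>+z. ennreal (gauss2 \<sigma> z) \<partial>lborel) = 1"
  unfolding gauss2_def
  by (simp add: ennreal_mult nn_integral_normal_density
        nn_integral_lborel_pair_mult[of "\<lambda>x. ennreal (normal_density 0 \<sigma> x)" "\<lambda>x. ennreal
            (normal_density 0 \<sigma> x)"])

text \<open>By evenness the autocorrelation is a convolution of two centred normal densities, whose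
  variances add; this is the origin of the factor \<open>sqrt 2\<close>.\<close>

lemma normal_density_autocorrelation:
  assumes "0 < \<sigma>"
  shows "(\<integral>\<^sup>+t. ennreal (normal_density 0 \<sigma> (x - t) * normal_density 0 \<sigma> (x' - t)) \<partial>lborel) =
    ennreal (normal_density 0 (sqrt 2 * \<sigma>) (x - x'))"
proof -
  have even: "normal_density 0 \<sigma> (- t) = normal_density 0 \<sigma> t" for t
    by (simp add: normal_density_def)
  have "(\<integral>\<^sup>+t. ennreal (normal_density 0 \<sigma> (x - t) * normal_density 0 \<sigma> (x' - t)) \<partial>lborel)
     = (\<integral>\<^sup>+t. ennreal (normal_density 0 \<sigma> (x - (t + x')) * normal_density 0 \<sigma> (x' - (t + x'))) \<partial>lborel)"
    by (rule nn_integral_lborel_translate[symmetric]) measurable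
  also have "\<dots> = (\<integral>\<^sup>+t. ennreal (normal_density 0 \<sigma> ((x - x') - t) * normal_density 0 \<sigma> t) \<partial>lborel)"
    by (simp add: even algebra_simps)
  also have "\<dots> = ennreal (normal_density 0 (sqrt (\<sigma>\<^sup>2 + \<sigma>\<^sup>2)) (x - x'))"
    using fun_cong[OF conv_normal_density_zero_mean[OF assms assms], of "x - x'"] .
  also have "sqrt (\<sigma>\<^sup>2 + \<sigma>\<^sup>2) = sqrt 2 * \<sigma>"
    using assms by (simp add: real_sqrt_mult flip: mult_2)
  finally show ?thesis .
qed

lemma gauss2_autocorrelation:
  assumes "0 < \<sigma>"
  shows "(\<integral>\<^sup>+t. ennreal (gauss2 \<sigma> (x - t) * gauss2 \<sigma> (x' - t)) \<partial>lborel) =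
      ennreal (gauss2 (sqrt 2 * \<sigma>) (x - x'))"
proof -
  let ?n = "\<lambda>a b t. ennreal (normal_density 0 \<sigma> (a - t) * normal_density 0 \<sigma> (b - t))"
  have "(\<integral>\<^sup>+t. ennreal (gauss2 \<sigma> (x - t) * gauss2 \<sigma> (x' - t)) \<partial>lborel)
     = (\<integral>\<^sup>+t. ?n (fst x) (fst x') (fst t) * ?n (snd x) (snd x') (snd t) \<partial>lborel)"
    by (intro nn_integral_cong) (simp add: gauss2_def mult_ac flip: ennreal_mult)
  also have "\<dots> = (\<integral>\<^sup>+t. ?n (fst x) (fst x') t \<partial>lborel) * (\<integral>\<^sup>+t. ?n (snd x) (snd x') t \<partial>lborel)"
    by (rule nn_integral_lborel_pair_mult) measurable
  also have "\<dots> = ennreal (gauss2 (sqrt 2 * \<sigma>) (x - x'))"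
    unfolding normal_density_autocorrelation[OF assms] by (simp add: gauss2_def ennreal_mult)
  finally show ?thesis .
qed

text \<open>Presents the narrow Gaussian as a dilate of the standard one, with one factor
  \<open>1 / \<sigma>\<close> per coordinate, the form that the mollifier limit expects.\<close>

lemma gauss2_scale:
  assumes "0 < \<sigma>"
  shows "gauss2 \<sigma> z = (1 / \<sigma>) ^ 2 * gauss2 1 ((1 / \<sigma>) *\<^sub>R z)"
proof -
  have "normal_density 0 \<sigma> x = 1 / \<sigma> * normal_density 0 1 (1 / \<sigma> * x)" for x
    using assms by (simp add: normal_density_def real_sqrt_mult power_divide mult_ac)
  then show ?thesis
    by (simp add: gauss2_def power2_eq_square)
qed

lemma gauss2_mollify_L1:
  fixes H :: "real \<times> real \<Rightarrow> 'b::{banach, second_countable_topology}"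
  assumes H: "integrable lborel H"
  shows "(\<lambda>n. \<integral>\<^sup>+t. norm ((\<integral>x. gauss2 (1 / real (Suc n)) (x - t) *\<^sub>R H x \<partial>lborel) - H t) \<partial>lborel) \<longlonglongrightarrow> 0"
proof (rule tendsto_sandwich[OF _ _ tendsto_const])
  show "(\<lambda>n. \<integral>\<^sup>+z. ennreal (real (Suc n) ^ DIM(real \<times> real) * gauss2 1 (real (Suc n) *\<^sub>R z) *
      L1_modulus H z) \<partial>lborel) \<longlonglongrightarrow> 0"
    by (rule mollifier_modulus_tendsto_0[OF H]) (auto simp: gauss2_nonneg nn_integral_gauss2)
  have eq: "gauss2 (1 / real (Suc n)) z = real (Suc n) ^ DIM(real \<times> real) *
      gauss2 1 (real (Suc n) *\<^sub>R z)" for n z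
    by (subst gauss2_scale) (auto simp: numeral_2_eq_2)
  show "\<forall>\<^sub>F n in sequentially. (\<integral>\<^sup>+t. norm ((\<integral>x. gauss2 (1 / real (Suc n)) (x - t) *\<^sub>R H x
      \<partial>lborel) - H t) \<partial>lborel)
    \<le> (\<integral>\<^sup>+z. ennreal (real (Suc n) ^ DIM(real \<times> real) * gauss2 1 (real (Suc n) *\<^sub>R z) *
        L1_modulus H z) \<partial>lborel)"
    unfolding eq[symmetric]
    by (intro always_eventually allI mollifier_L1_bound[OF H _ _ gauss2_le])
       (auto simp: gauss2_nonneg nn_integral_gauss2)
qed simp

section \<open>Plancherel inequality for the two-sided quaternion Fourier transform\<close>

abbreviation phase :: "quat \<Rightarrow> real \<Rightarrow> quat" where
  "phase u t \<equiv> slice u (cis t)"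

section \<open>Phases as isometries and their Gaussian integrals\<close>

lemma inner_quat_mult_left: "(p * q) \<bullet> (p * q') = (norm p)\<^sup>2 * (q \<bullet> q')" for p q q' :: quat
  by (simp add: inner_quat_def norm_quat_def power2_eq_square algebra_simps)

lemma inner_quat_mult_right: "(q * p) \<bullet> (q' * p) = (norm p)\<^sup>2 * (q \<bullet> q')" for p q q' :: quat
  by (simp add: inner_quat_def norm_quat_def power2_eq_square algebra_simps)

lemma norm_phase: "u = qi \<or> u = qj \<Longrightarrow> norm (phase u t) = 1"
  by (simp add: norm_slice)

lemma unit_sq: "u = qi \<or> u = qj \<Longrightarrow> u * u = -1"
  by (auto simp: quat_units)

lemma phase_add: "u = qi \<or> u = qj \<Longrightarrow> phase u (s + t) = phase u s * phase u t"
  by (simp add: cis_mult[symmetric] slice_mult unit_sq)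

text \<open>Multiplication by a unit quaternion, from either side, preserves the inner product. Left
  phases share one slice and right phases another, so the common part cancels although the slices do
  not commute with each other. This makes the Gram kernel a function of
  \<open>x - x'\<close>.\<close>

lemma inner_phase_conj:
  "(phase qi a * p * phase qj b) \<bullet> (phase qi a' * p' * phase qj b') =
     (phase qi (a - a') * p * phase qj (b - b')) \<bullet> p'"
proof -
  have "phase qi a = phase qi a' * phase qi (a - a')" "phase qj b = phase qj (b - b') * phase qj b'"
    by (simp_all flip: phase_add)
  then have "(phase qi a * p * phase qj b) \<bullet> (phase qi a' * p' * phase qj b') =
     (phase qi a' * ((phase qi (a - a') * p * phase qj (b - b')) * phase qj b'))
         \<bullet> (phase qi a' * (p' * phase qj b'))"
    by (simp add: mult.assoc)
  also have "\<dots> = (phase qi (a - a') * p * phase qj (b - b')) \<bullet> p'"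
    unfolding inner_quat_mult_left inner_quat_mult_right by (simp add: norm_phase)
  finally show ?thesis .
qed

lemma slice_measurable [measurable]: "slice u \<in> borel_measurable borel"
  by (intro borel_measurable_continuous_onI linear_continuous_on slice_bounded_linear)

lemma cis_measurable [measurable]: "cis \<in> borel_measurable borel"
  by (intro borel_measurable_continuous_onI continuous_on_cis continuous_on_id)

text \<open>After rescaling, the integral is the characteristic function of the standard normal
  distribution. The value is written as a normal density of width \<open>sqrt 2 * \<sigma>\<close>
  to match the autocorrelation above.\<close>

lemma has_bochner_integral_gauss_cis:
  assumes "0 < \<sigma>" "b \<noteq> 0"
  shows "has_bochner_integral lborel (\<lambda>\<omega>. exp (- (\<sigma> * \<omega> / b)\<^sup>2) *\<^sub>R cis (- (c * \<omega> / b)))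
    (complex_of_real (2 * pi * \<bar>b\<bar> * normal_density 0 (sqrt 2 * \<sigma>) c))"
proof -
  \<comment> \<open>The substitution \<open>\<omega> = k * z\<close> turns the damping into
    \<open>exp (- z\<^sup>2 / 2)\<close> and the oscillation into frequency
    \<open>t\<close>.\<close>
  define k where "k = b / (sqrt 2 * \<sigma>)"
  have k: "k \<noteq> 0" using assms by (simp add: k_def)
  define t where "t = - (c / (sqrt 2 * \<sigma>))"
  have int: "integrable lborel (\<lambda>z. std_normal_density z *\<^sub>R cis (t * z))"
  proof (rule Bochner_Integration.integrable_bound)
    show "integrable lborel std_normal_density" by simp
  qed auto
  have "char std_normal_distribution t = (\<integral>z. std_normal_density z *\<^sub>R cis (t * z) \<partial>lborel)"
    unfolding char_def by (subst integral_density) (auto simp: cis_conv_exp)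
  then have val: "(\<integral>z. std_normal_density z *\<^sub>R cis (t * z) \<partial>lborel) = of_real (exp (- (t\<^sup>2) / 2))"
    by (simp add: char_std_normal_distribution)
  let ?f = "\<lambda>\<omega>. exp (- (\<sigma> * \<omega> / b)\<^sup>2) *\<^sub>R cis (- (c * \<omega> / b))"
  have f_eq: "?f (0 + k * z) = sqrt (2 * pi) *\<^sub>R (std_normal_density z *\<^sub>R cis (t * z))" for z
  proof -
    have "(\<sigma> * (k * z) / b)\<^sup>2 = z\<^sup>2 / 2" "- (c * (k * z) / b) = t * z"
      using assms by (simp_all add: k_def t_def power_mult_distrib power_divide)
    then show ?thesis by (simp add: std_normal_density_def)
  qed
  have "integrable lborel (\<lambda>z. ?f (0 + k * z))"
    unfolding f_eq by (rule integrable_scaleR_right[OF int])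
  then have f_int: "integrable lborel ?f"
    using lborel_integrable_real_affine_iff[OF k] by blast
  have "integral\<^sup>L lborel ?f = \<bar>k\<bar> *\<^sub>R (\<integral>z. ?f (0 + k * z) \<partial>lborel)"
    by (rule lborel_integral_real_affine[OF k])
  also have "\<dots> = \<bar>k\<bar> *\<^sub>R sqrt (2 * pi) *\<^sub>R complex_of_real (exp (- (t\<^sup>2) / 2))"
    unfolding f_eq by (subst integral_scaleR_right) (simp add: val)
  also have "\<dots> = complex_of_real (\<bar>k\<bar> * sqrt (2 * pi) * exp (- (t\<^sup>2) / 2))"
    by (simp add: scaleR_conv_of_real)
  also have "\<bar>k\<bar> * sqrt (2 * pi) * exp (- (t\<^sup>2) / 2) = 2 * pi * \<bar>b\<bar> * normal_density 0 (sqrt 2 * \<sigma>) c"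
  proof -
    have "sqrt (2 * pi * (sqrt 2 * \<sigma>)\<^sup>2) = sqrt (2 * pi) * (sqrt 2 * \<sigma>)"
      using assms by (simp add: real_sqrt_mult)
    moreover have "sqrt (2 * pi) * sqrt (2 * pi) = 2 * pi" by simp
    moreover have "- (t\<^sup>2) / 2 = - (c - 0)\<^sup>2 / (2 * (sqrt 2 * \<sigma>)\<^sup>2)"
      by (simp add: t_def power_divide)
    moreover have "\<bar>k\<bar> = \<bar>b\<bar> / (sqrt 2 * \<sigma>)" using assms by (simp add: k_def abs_mult)
    \<comment> \<open>To be read with \<open>B = \<bar>b\<bar>\<close>,
      \<open>S = sqrt 2 * \<sigma>\<close>, \<open>R = sqrt (2 * pi)\<close> and \<open>E\<close>
      the exponential; \<open>R * R\<close> becomes \<open>2 * pi\<close>.\<close>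
    moreover have "B / S * R * E = (R * R) * B * (1 / (R * S) * E)" if "R \<noteq> 0" for B S R E :: real
      using that by (simp add: field_simps)
    ultimately show ?thesis
      unfolding normal_density_def by (metis real_sqrt_eq_zero_cancel_iff pi_neq_zero
          mult_eq_0_iff zero_neq_numeral)
  qed
  finally show ?thesis using f_int by (simp add: has_bochner_integral_iff)
qed

text \<open>The complex value is real, so its image is the same for every \<open>u\<close> and is
  central in the quaternions.\<close>

lemma has_bochner_integral_gauss_phase:
  assumes "0 < \<sigma>" "b \<noteq> 0"
  shows "has_bochner_integral lborel (\<lambda>\<omega>. exp (- (\<sigma> * \<omega> / b)\<^sup>2) *\<^sub>R phase u (- (c * \<omega> / b)))
    (of_real (2 * pi * \<bar>b\<bar> * normal_density 0 (sqrt 2 * \<sigma>) c))"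
proof -
  interpret bounded_linear "slice u" by (rule slice_bounded_linear)
  show ?thesis
    using has_bochner_integral_bounded_linear[OF slice_bounded_linear
        has_bochner_integral_gauss_cis[OF assms, of c], of u]
    by (simp add: scaleR del: of_real_mult)
qed

text \<open>The left factor depends on the first frequency and the right factor on the second, so
  Fubini separates them around \<open>q\<close>. Each one-dimensional integral is real and can be
  moved past \<open>q\<close>; their constants multiply to
  \<open>4 * pi\<^sup>2 * \<bar>b1 * b2\<bar>\<close>.\<close>

lemma gauss_phase_integral2:
  assumes "0 < \<sigma>" "b1 \<noteq> 0" "b2 \<noteq> 0"
  shows "has_bochner_integral lborel
    (\<lambda>\<omega>. (exp (- (\<sigma> * fst \<omega> / b1)\<^sup>2) * exp (- (\<sigma> * snd \<omega> / b2)\<^sup>2)) *\<^sub>R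
        (phase qi (- (fst z * fst \<omega> / b1)) * q * phase qj (- (snd z * snd \<omega> / b2))))
    ((4 * pi\<^sup>2 * \<bar>b1 * b2\<bar> * gauss2 (sqrt 2 * \<sigma>) z) *\<^sub>R q)" (is "has_bochner_integral _ ?f ?v")
proof -
  let ?A = "\<lambda>\<omega>. exp (- (\<sigma> * \<omega> / b1)\<^sup>2) *\<^sub>R phase qi (- (fst z * \<omega> / b1))"
  let ?B = "\<lambda>\<omega>. exp (- (\<sigma> * \<omega> / b2)\<^sup>2) *\<^sub>R phase qj (- (snd z * \<omega> / b2))"
  note A = has_bochner_integral_gauss_phase[OF assms(1,2), of qi "fst z"]
  note B = has_bochner_integral_gauss_phase[OF assms(1,3), of qj "snd z"]
  have AB: "?f \<omega> = ?A (fst \<omega>) * q * ?B (snd \<omega>)" for \<omega>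
    by simp
  have int: "integrable (lborel \<Otimes>\<^sub>M lborel) (\<lambda>\<omega>. ?A (fst \<omega>) * q * ?B (snd \<omega>))"
  proof (rule integrableI_bounded)
    have [measurable]: "?A \<in> borel_measurable borel" "?B \<in> borel_measurable borel"
      by measurable
    show "(\<lambda>\<omega>. ?A (fst \<omega>) * q * ?B (snd \<omega>)) \<in> borel_measurable (lborel \<Otimes>\<^sub>M lborel)"
      by measurable
    have "(\<integral>\<^sup>+\<omega>. norm (?A (fst \<omega>) * q * ?B (snd \<omega>)) \<partial>(lborel \<Otimes>\<^sub>M lborel)) =
       (\<integral>\<^sup>+\<omega>. (ennreal (norm (?A (fst \<omega>))) * ennreal (norm q)) * ennreal (norm (?B (snd \<omega>))) \<partial>lborel)"
      unfolding lborel_prod by (intro nn_integral_cong) (simp add: norm_mult ennreal_mult mult_ac)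
    also have "\<dots> = (\<integral>\<^sup>+\<omega>. ennreal (norm (?A \<omega>)) * ennreal (norm q) \<partial>lborel) *
        (\<integral>\<^sup>+\<omega>. ennreal (norm (?B \<omega>)) \<partial>lborel)"
      by (rule nn_integral_lborel_pair_mult) measurable
    also have "\<dots> = (\<integral>\<^sup>+\<omega>. ennreal (norm (?A \<omega>)) \<partial>lborel) * ennreal (norm q) *
        (\<integral>\<^sup>+\<omega>. ennreal (norm (?B \<omega>)) \<partial>lborel)"
      by (subst nn_integral_multc) auto
    also have "\<dots> < \<infinity>"
      using A B unfolding has_bochner_integral_iff integrable_iff_bounded
      by (auto simp: ennreal_mult_less_top)
    finally show "(\<integral>\<^sup>+\<omega>. norm (?A (fst \<omega>) * q * ?B (snd \<omega>)) \<partial>(lborel \<Otimes>\<^sub>M lborel)) < \<infinity>" .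
  qed
  have "(\<integral>\<omega>. ?A (fst \<omega>) * q * ?B (snd \<omega>) \<partial>(lborel \<Otimes>\<^sub>M lborel)) =
     (\<integral>x. (\<integral>y. ?A (fst (x, y)) * q * ?B (snd (x, y)) \<partial>lborel) \<partial>lborel)"
    by (rule lborel_pair.integral_fst'[OF int, symmetric])
  also have "\<dots> = (\<integral>x. ?A x * q * of_real (2 * pi * \<bar>b2\<bar> * normal_density 0 (sqrt 2 * \<sigma>) (snd z))
      \<partial>lborel)"
    unfolding fst_conv snd_conv
    by (intro Bochner_Integration.integral_cong refl)
       (use B in \<open>simp add: has_bochner_integral_iff del: of_real_mult mult_scaleR_left
           mult_scaleR_right\<close>)
  also have "\<dots> = of_real (2 * pi * \<bar>b1\<bar> * normal_density 0 (sqrt 2 * \<sigma>) (fst z)) * q *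
      of_real (2 * pi * \<bar>b2\<bar> * normal_density 0 (sqrt 2 * \<sigma>) (snd z))"
    using A by (simp add: has_bochner_integral_iff del: of_real_mult mult_scaleR_left mult_scaleR_right)
  also have "\<dots> = ?v"
    by (simp add: of_real_def gauss2_def abs_mult power2_eq_square mult_ac)
  finally show ?thesis
    unfolding AB using int by (simp add: has_bochner_integral_iff lborel_prod)
qed

section \<open>The transform of an integrable function\<close>

lemma fst_snd_borel [measurable]:
  "fst \<in> borel_measurable (borel :: ('a::topological_space \<times> 'b::topological_space) measure)"
  "snd \<in> borel_measurable (borel :: ('a \<times> 'b) measure)"
  by (intro borel_measurable_continuous_onI continuous_on_fst continuous_on_snd continuous_on_id)+

text \<open>The two-sided quaternion Fourier transform, with frequencies divided by
  \<open>b1\<close> and \<open>b2\<close> as in the kernels and without normalisation.\<close>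

definition qft :: "real \<Rightarrow> real \<Rightarrow> (real \<times> real \<Rightarrow> quat) \<Rightarrow> real \<times> real \<Rightarrow> quat" where
  "qft b1 b2 H \<omega> = (\<integral>x. phase qi (- (fst x * fst \<omega> / b1)) * H x *
      phase qj (- (snd x * snd \<omega> / b2)) \<partial>lborel)"

lemma qft_integrand_measurable:
  assumes [measurable]: "H \<in> borel_measurable borel"
  shows "(\<lambda>(x, \<omega>). phase qi (- (fst x * fst \<omega> / b1)) * H x * phase qj (- (snd x * snd \<omega> / b2)))
    \<in> borel_measurable (borel \<Otimes>\<^sub>M borel)"
  by measurable

lemma qft_integrand_integrable:
  fixes H :: "real \<times> real \<Rightarrow> quat"
  assumes "integrable lborel H"
  shows "integrable lborel (\<lambda>x. phase qi (- (fst x * fst \<omega> / b1)) * H x *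
      phase qj (- (snd x * snd \<omega> / b2)))"
proof (rule Bochner_Integration.integrable_bound[OF assms])
  have [measurable]: "H \<in> borel_measurable borel" using assms by auto
  show "(\<lambda>x. phase qi (- (fst x * fst \<omega> / b1)) * H x * phase qj (- (snd x * snd \<omega> / b2)))
      \<in> borel_measurable lborel"
    by measurable
qed (simp add: norm_mult norm_phase)

lemma qft_measurable:
  assumes "H \<in> borel_measurable borel"
  shows "qft b1 b2 H \<in> borel_measurable borel"
proof -
  have "(\<lambda>(\<omega>, x). phase qi (- (fst x * fst \<omega> / b1)) * H x * phase qj (- (snd x * snd \<omega> / b2)))
    \<in> borel_measurable (borel \<Otimes>\<^sub>M lborel)"
    using measurable_compose[OF measurable_pair_swap' qft_integrand_measurable[OF assms, of b1 b2]]
    by (simp add: case_prod_beta' cong: measurable_cong_sets)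
  then show ?thesis
    unfolding qft_def[abs_def] by (rule lborel.borel_measurable_lebesgue_integral)
qed

text \<open>The damped transform and the mollified function have Gram kernels that agree up to the
  constant: both are multiples of
  \<open>gauss2 (sqrt 2 * \<sigma>) (x - x') * (H x \<bullet> H x')\<close>. The damping is at most
  1, so removing it can only increase the energy.\<close>

lemma qft_mollified_plancherel:
  fixes H :: "real \<times> real \<Rightarrow> quat"
  assumes H: "integrable lborel H" and "0 < \<sigma>" "b1 \<noteq> 0" "b2 \<noteq> 0"
  shows "ennreal (4 * pi\<^sup>2 * \<bar>b1 * b2\<bar>) * (\<integral>\<^sup>+t. ennreal
      ((norm (\<integral>x. gauss2 \<sigma> (x - t) *\<^sub>R H x \<partial>lborel))\<^sup>2) \<partial>lborel)
    \<le> (\<integral>\<^sup>+\<omega>. ennreal ((norm (qft b1 b2 H \<omega>))\<^sup>2) \<partial>lborel)"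
proof -
  have [measurable]: "H \<in> borel_measurable borel" using H by auto
  let ?K = "4 * pi\<^sup>2 * \<bar>b1 * b2\<bar>"
  let ?\<tau> = "sqrt 2 * \<sigma>"
  \<comment> \<open>Half the exponent, because \<open>w\<close> appears squared in the
    energy.\<close>
  define w where "w \<omega> = exp (- (\<sigma> * fst \<omega> / b1)\<^sup>2 / 2) * exp (- (\<sigma> * snd \<omega> / b2)\<^sup>2 / 2)" for \<omega>
  have w2: "w \<omega> * w \<omega> = exp (- (\<sigma> * fst \<omega> / b1)\<^sup>2) * exp (- (\<sigma> * snd \<omega> / b2)\<^sup>2)" for \<omega>
    by (simp add: w_def flip: exp_add)
  have w_nonneg: "0 \<le> w \<omega>" and w_le: "w \<omega> \<le> 1" for \<omega>
    by (simp_all add: w_def flip: exp_add)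
  have [measurable]: "w \<in> borel_measurable borel"
    unfolding w_def[abs_def] by measurable
  let ?E = "\<lambda>x \<omega>. phase qi (- (fst x * fst \<omega> / b1)) * H x * phase qj (- (snd x * snd \<omega> / b2))"
  define F where "F = (\<lambda>x \<omega>. w \<omega> *\<^sub>R ?E x \<omega>)"
  define G where "G = (\<lambda>x t. gauss2 \<sigma> (x - t) *\<^sub>R H x)"
  \<comment> \<open>The bound on the narrow Gaussian makes \<open>G\<close> integrable in
    \<open>x\<close>; the bound on the wide one gives the product estimate for
    \<open>G\<close>.\<close>
  obtain C where C: "\<And>z. gauss2 \<sigma> z \<le> C" "\<And>z. gauss2 ?\<tau> z \<le> C" "0 \<le> C"
  proof
    let ?C = "max (1 / sqrt (2 * pi * \<sigma>\<^sup>2) * (1 / sqrt (2 * pi * \<sigma>\<^sup>2)))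
        (1 / sqrt (2 * pi * ?\<tau>\<^sup>2) * (1 / sqrt (2 * pi * ?\<tau>\<^sup>2)))"
    show "gauss2 \<sigma> z \<le> ?C" "gauss2 ?\<tau> z \<le> ?C" for z
      using gauss2_le[of \<sigma> z] gauss2_le[of ?\<tau> z] by auto
    show "0 \<le> ?C" by (simp add: le_max_iff_disj)
  qed
  have sf: "sigma_finite_measure (lborel :: (real \<times> real) measure)" by (rule sigma_finite_lborel)
  \<comment> \<open>At \<open>z = 0\<close> with \<open>q = 1\<close> the phases are trivial, which
    leaves the mass of the squared damping.\<close>
  have int_w: "has_bochner_integral lborel (\<lambda>\<omega>. w \<omega> * w \<omega>) (?K * gauss2 ?\<tau> 0)"
    using has_bochner_integral_bounded_linear[OF bounded_linear_inner_left[of 1]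
        gauss_phase_integral2[OF assms(2-4), of 0 1]]
    by (simp add: w2 inner_quat_def)
  \<comment> \<open>The square root shares the constant between the two factors of the product
    bound.\<close>
  let ?hF = "\<lambda>x. sqrt (?K * gauss2 ?\<tau> 0) * norm (H x)"
  have FF: "(\<integral>\<omega>. F x \<omega> \<bullet> F x' \<omega> \<partial>lborel) = ?K * gauss2 ?\<tau> (x - x') * (H x \<bullet> H x')" for x x'
  proof -
    have "F x \<omega> \<bullet> F x' \<omega> = ((w \<omega> * w \<omega>) *\<^sub>R (phase qi (- (fst (x - x') * fst \<omega> / b1)) * H x *
        phase qj (- (snd (x - x') * snd \<omega> / b2)))) \<bullet> H x'" for \<omega>
      unfolding F_def inner_scaleR_left inner_scaleR_right inner_phase_conj
      by (simp add: diff_divide_distrib left_diff_distrib mult.assoc[where 'a = real])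
    then show ?thesis
      using has_bochner_integral_bounded_linear[OF bounded_linear_inner_left[of "H x'"]
          gauss_phase_integral2[OF assms(2-4), of "x - x'" "H x"]]
      by (simp add: w2 has_bochner_integral_iff)
  qed
  have GG: "(\<integral>t. G x t \<bullet> G x' t \<partial>lborel) = gauss2 ?\<tau> (x - x') * (H x \<bullet> H x')" for x x'
  proof -
    have "(\<integral>t. gauss2 \<sigma> (x - t) * gauss2 \<sigma> (x' - t) \<partial>lborel) = gauss2 ?\<tau> (x - x')"
      using gauss2_autocorrelation[OF assms(2), of x x'] gauss2_nonneg
      by (subst integral_eq_nn_integral) auto
    then show ?thesis
      by (simp add: G_def mult.assoc[symmetric] mult.commute[of "gauss2 \<sigma> (x' - _)"])
  qed
  have F_meas: "case_prod F \<in> borel_measurable (lborel \<Otimes>\<^sub>M lborel)"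
    unfolding F_def using qft_integrand_measurable[of H b1 b2] by (simp add: case_prod_beta')
  have F_int: "integrable lborel (\<lambda>x. F x \<omega>)" for \<omega>
    unfolding F_def using qft_integrand_integrable[OF H] by simp
  have F_bound: "(\<integral>\<^sup>+\<omega>. ennreal (norm (F x \<omega>) * norm (F x' \<omega>)) \<partial>lborel) \<le>
      ennreal (?hF x * ?hF x')" for x x'
  proof -
    have "(\<integral>\<^sup>+\<omega>. ennreal (norm (F x \<omega>) * norm (F x' \<omega>)) \<partial>lborel) =
        (\<integral>\<^sup>+\<omega>. ennreal (w \<omega> * w \<omega>) * ennreal (norm (H x) * norm (H x')) \<partial>lborel)"
      by (intro nn_integral_cong) (simp add: F_def norm_mult norm_phase w_nonneg mult_ac flip:
          ennreal_mult)
    also have "\<dots> = ennreal (?K * gauss2 ?\<tau> 0) * ennreal (norm (H x) * norm (H x'))"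
      using int_w w_nonneg by (simp add: nn_integral_multc nn_integral_eq_integral
          has_bochner_integral_iff)
    also have "\<dots> = ennreal (?hF x * ?hF x')"
      by (simp add: gauss2_nonneg mult_ac flip: ennreal_mult)
    finally show ?thesis by simp
  qed
  let ?hG = "\<lambda>x. sqrt C * norm (H x)"
  have G_meas: "case_prod G \<in> borel_measurable (lborel \<Otimes>\<^sub>M lborel)"
    unfolding G_def by measurable
  have G_int: "integrable lborel (\<lambda>x. G x t)" for t
  proof (rule Bochner_Integration.integrable_bound)
    show "integrable lborel (\<lambda>x. C * norm (H x))" using H by simp
    show "AE x in lborel. norm (G x t) \<le> norm (C * norm (H x))"
      using C gauss2_nonneg by (intro AE_I2) (simp add: G_def abs_mult mult_right_mono)
  qed (simp add: G_def)
  have G_bound: "(\<integral>\<^sup>+t. ennreal (norm (G x t) * norm (G x' t)) \<partial>lborel) \<le>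
      ennreal (?hG x * ?hG x')" for x x'
  proof -
    have "(\<integral>\<^sup>+t. ennreal (norm (G x t) * norm (G x' t)) \<partial>lborel) =
        (\<integral>\<^sup>+t. ennreal (gauss2 \<sigma> (x - t) * gauss2 \<sigma> (x' - t)) *
        ennreal (norm (H x) * norm (H x')) \<partial>lborel)"
      by (intro nn_integral_cong) (simp add: G_def gauss2_nonneg mult_ac flip: ennreal_mult)
    also have "\<dots> = ennreal (gauss2 ?\<tau> (x - x')) * ennreal (norm (H x) * norm (H x'))"
      by (simp add: nn_integral_multc gauss2_autocorrelation[OF assms(2)])
    also have "\<dots> \<le> ennreal C * ennreal (norm (H x) * norm (H x'))"
      by (intro mult_right_mono ennreal_leI C) auto
    also have "\<dots> = ennreal (?hG x * ?hG x')"
      using C(3) by (simp add: mult_ac flip: ennreal_mult)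
    finally show ?thesis .
  qed
  have hF: "integrable lborel ?hF" "\<And>x. 0 \<le> ?hF x" and hG: "integrable lborel ?hG" "\<And>x. 0 \<le> ?hG x"
    using H C(3) by (auto simp: gauss2_nonneg)
  note F_gram = gram_integral[OF sf sf F_meas F_int hF F_bound]
  note G_gram = gram_integral[OF sf sf G_meas G_int hG G_bound]
  have "ennreal ?K * (\<integral>\<^sup>+t. ennreal ((norm (\<integral>x. G x t \<partial>lborel))\<^sup>2) \<partial>lborel) =
      ennreal (?K * (\<integral>t. (norm (\<integral>x. G x t \<partial>lborel))\<^sup>2 \<partial>lborel))"
    using G_gram(1) by (simp add: nn_integral_eq_integral ennreal_mult)
  also have "?K * (\<integral>t. (norm (\<integral>x. G x t \<partial>lborel))\<^sup>2 \<partial>lborel) =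
      (\<integral>\<omega>. (norm (\<integral>x. F x \<omega> \<partial>lborel))\<^sup>2 \<partial>lborel)"
    unfolding F_gram(2) G_gram(2) FF GG by (simp add: mult.assoc)
  also have "ennreal \<dots> = (\<integral>\<^sup>+\<omega>. ennreal ((norm (\<integral>x. F x \<omega> \<partial>lborel))\<^sup>2) \<partial>lborel)"
    using F_gram(1) by (simp add: nn_integral_eq_integral)
  also have "\<dots> \<le> (\<integral>\<^sup>+\<omega>. ennreal ((norm (qft b1 b2 H \<omega>))\<^sup>2) \<partial>lborel)"
  proof (intro nn_integral_mono ennreal_leI power_mono)
    fix \<omega>
    have "(\<integral>x. F x \<omega> \<partial>lborel) = w \<omega> *\<^sub>R qft b1 b2 H \<omega>"
      unfolding F_def qft_def by (rule integral_scaleR_right)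
    then show "norm (\<integral>x. F x \<omega> \<partial>lborel) \<le> norm (qft b1 b2 H \<omega>)"
      using w_nonneg[of \<omega>] w_le[of \<omega>] by (simp add: mult_left_le_one_le)
  qed auto
  finally show ?thesis by (simp add: G_def)
qed

text \<open>The mollified inequality for widths \<open>1 / Suc n\<close>, followed by an almost
  everywhere convergent subsequence and Fatou's lemma. The statement lives in
  \<open>[0, \<infinity>]\<close>, as an integrable \<open>H\<close> may fail to be square
  integrable.\<close>

lemma qft_plancherel_le:
  fixes H :: "real \<times> real \<Rightarrow> quat"
  assumes H: "integrable lborel H" and b: "b1 \<noteq> 0" "b2 \<noteq> 0"
  shows "ennreal (4 * pi\<^sup>2 * \<bar>b1 * b2\<bar>) * (\<integral>\<^sup>+x. ennreal ((norm (H x))\<^sup>2) \<partial>lborel)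
    \<le> (\<integral>\<^sup>+\<omega>. ennreal ((norm (qft b1 b2 H \<omega>))\<^sup>2) \<partial>lborel)" (is "ennreal ?K * _ \<le> ?Q")
proof -
  have [measurable]: "H \<in> borel_measurable borel" using H by auto
  define R where "R = (\<lambda>n t. \<integral>x. gauss2 (1 / real (Suc n)) (x - t) *\<^sub>R H x \<partial>lborel)"
  have [measurable]: "R n \<in> borel_measurable borel" for n
    unfolding R_def by measurable
  have lim: "(\<lambda>n. \<integral>\<^sup>+t. norm (R n t - H t) \<partial>lborel) \<longlonglongrightarrow> 0"
    unfolding R_def by (rule gauss2_mollify_L1[OF H])
  \<comment> \<open>From \<open>N\<close> on the errors have finite L1 norm, so convergence can be
    restated with Bochner integrals and the subsequence theorem applies.\<close>
  obtain N where N: "\<And>n. n \<ge> N \<Longrightarrow> (\<integral>\<^sup>+t. norm (R n t - H t) \<partial>lborel) < 1"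
    using order_tendstoD(2)[OF lim, of 1] by (auto simp: eventually_sequentially)
  have int: "integrable lborel (\<lambda>t. R (n + N) t - H t)" for n
    by (rule integrableI_bounded) (use N[of "n + N"] order.strict_trans[OF _ ennreal_one_less_top]
        in auto)
  have "(\<lambda>n. \<integral>t. norm (R (n + N) t - H t) \<partial>lborel) \<longlonglongrightarrow> 0"
  proof -
    have "(\<lambda>n. ennreal (\<integral>t. norm (R (n + N) t - H t) \<partial>lborel)) \<longlonglongrightarrow> ennreal 0"
      using LIMSEQ_ignore_initial_segment[OF lim, of N] int by (simp add: nn_integral_eq_integral)
    then show ?thesis by (subst (asm) tendsto_ennreal_iff) auto
  qed
  from tendsto_L1_AE_subseq[OF int this]
  obtain r :: "nat \<Rightarrow> nat" where "AE t in lborel. (\<lambda>n. R (r n + N) t - H t) \<longlonglongrightarrow> 0"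
    by blast
  then have "AE t in lborel. ennreal ((norm (H t))\<^sup>2) = liminf (\<lambda>n. ennreal ((norm (R (r n + N) t))\<^sup>2))"
  proof eventually_elim
    case (elim t)
    have "(\<lambda>n. R (r n + N) t) \<longlonglongrightarrow> H t"
      using elim by (simp add: LIM_zero_iff)
    then have "(\<lambda>n. ennreal ((norm (R (r n + N) t))\<^sup>2)) \<longlonglongrightarrow> ennreal ((norm (H t))\<^sup>2)"
      by (intro tendsto_intros tendsto_ennrealI)
    then show ?case using lim_imp_Liminf[OF sequentially_bot] by metis
  qed
  then have "(\<integral>\<^sup>+x. ennreal ((norm (H x))\<^sup>2) \<partial>lborel) =
      (\<integral>\<^sup>+x. liminf (\<lambda>n. ennreal ((norm (R (r n + N) x))\<^sup>2)) \<partial>lborel)"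
    by (rule nn_integral_cong_AE)
  also have "\<dots> \<le> liminf (\<lambda>n. \<integral>\<^sup>+x. ennreal ((norm (R (r n + N) x))\<^sup>2) \<partial>lborel)"
    by (rule nn_integral_liminf) measurable
  also have "\<dots> \<le> ?Q / ennreal ?K"
  proof (rule Liminf_le)
    show "\<forall>\<^sub>F n in sequentially. (\<integral>\<^sup>+x. ennreal ((norm (R (r n + N) x))\<^sup>2) \<partial>lborel) \<le> ?Q / ennreal ?K"
    proof (intro always_eventually allI)
      fix n
      show "(\<integral>\<^sup>+x. ennreal ((norm (R (r n + N) x))\<^sup>2) \<partial>lborel) \<le> ?Q / ennreal ?K"
        using qft_mollified_plancherel[OF H _ b, of "1 / real (Suc (r n + N))"] b
          divide_right_mono_ennreal[of "ennreal ?K * _" ?Q "ennreal ?K"]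
        unfolding R_def by (simp add: ennreal_times_divide[symmetric]
            mult.commute[of "ennreal ?K"] mult_divide_eq_ennreal)
    qed
  qed simp
  finally have "ennreal ?K * (\<integral>\<^sup>+x. ennreal ((norm (H x))\<^sup>2) \<partial>lborel) \<le> ennreal ?K * (?Q / ennreal ?K)"
    by (rule mult_left_mono) simp
  also have "\<dots> = ?Q"
    using b by (simp add: ennreal_times_divide mult.commute[of "ennreal ?K"] mult_divide_eq_ennreal)
  finally show ?thesis .
qed

section \<open>The Gabor transform\<close>

lemma lebesgue_ex_borel_AE_eq:
  fixes f :: "'a::euclidean_space \<Rightarrow> 'b::euclidean_space"
  assumes "f \<in> borel_measurable lebesgue"
  obtains g where "g \<in> borel_measurable borel" "AE x in lborel. f x = g x"
proof -
  have "\<forall>b\<in>Basis. \<exists>g\<in>borel_measurable lborel. AE x in lborel. f x \<bullet> b = g x"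
    using assms by (intro ballI completion_ex_borel_measurable_real) auto
  then obtain g where g: "\<And>b. b \<in> Basis \<Longrightarrow> g b \<in> borel_measurable borel"
      "\<And>b. b \<in> Basis \<Longrightarrow> AE x in lborel. f x \<bullet> b = g b x"
    by (simp add: bchoice_iff) metis
  show thesis
  proof
    show "(\<lambda>x. \<Sum>b\<in>Basis. g b x *\<^sub>R b) \<in> borel_measurable borel"
      using g(1) by (intro borel_measurable_sum borel_measurable_scaleR) auto
    have "AE x in lborel. \<forall>b\<in>Basis. f x \<bullet> b = g b x"
      using g(2) by (intro AE_finite_allI) auto
    then show "AE x in lborel. f x = (\<Sum>b\<in>Basis. g b x *\<^sub>R b)"
    proof eventually_elim
      case (elim x)
      then show ?case using euclidean_representation[of "f x"] by simp
    qed
  qed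
qed

lemma AE_lborel_translate:
  fixes z :: "'a::euclidean_space"
  assumes "AE x in lborel. P x"
  shows "AE x in lborel. P (z + x)"
proof (rule AE_distrD[of "(+) z" lborel borel])
  show "AE x in distr lborel borel ((+) z). P x"
    unfolding lborel_distr_plus by (fact assms)
qed simp

lemma lebesgue_measurable_translate:
  fixes f :: "'a::euclidean_space \<Rightarrow> 'b::topological_space"
  assumes "f \<in> borel_measurable lebesgue"
  shows "(\<lambda>x. f (z + x)) \<in> borel_measurable lebesgue"
proof -
  have "(\<lambda>x. z + x) \<in> lebesgue \<rightarrow>\<^sub>M lebesgue"
    using lebesgue_affine_measurable[of "\<lambda>_. 1" z] by (simp add: euclidean_representation)
  then show ?thesis using assms by (rule measurable_compose)
qed

lemma qcnj_measurable [measurable]: "qcnj \<in> borel_measurable borel"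
proof -
  have "bounded_linear qcnj"
    by (rule bounded_linear_intro[where K = 1]) (auto simp: quat_eq_iff norm_quat_def)
  then show ?thesis
    by (intro borel_measurable_continuous_onI linear_continuous_on)
qed

lemma norm_qcnj [simp]: "norm (qcnj q) = norm q"
  by (simp add: norm_quat_def)

lemma lct_kernel_measurable [measurable]:
  assumes "u = qi \<or> u = qj" and [measurable]: "f \<in> borel_measurable M" "g \<in> borel_measurable M"
  shows "(\<lambda>x. lct_kernel u A (f x) (g x)) \<in> borel_measurable M"
  unfolding lct_kernel_eq[OF unit_sq[OF assms(1)]] by measurable

text \<open>The windowed function together with those kernel factors that are quadratic in
  \<open>x\<close>. They have modulus one, and \<open>qft\<close> of this product is the Gabor
  transform up to outer factors depending on the frequency alone.\<close>

definition chirped_window ::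
  "real^2^2 \<Rightarrow> real^2^2 \<Rightarrow> (real \<times> real \<Rightarrow> quat) \<Rightarrow> (real \<times> real \<Rightarrow> quat) \<Rightarrow> real \<times> real \<Rightarrow>
    real \<times> real \<Rightarrow> quat" where
  "chirped_window A1 A2 \<phi> f y x = phase qi (A1 $ 1 $ 1 / A1 $ 1 $ 2 * (fst x)\<^sup>2 / 2) * f x *
      qcnj (\<phi> (x - y)) * phase qj (A2 $ 1 $ 1 / A2 $ 1 $ 2 * (snd x)\<^sup>2 / 2)"

lemma norm_chirped_window: "norm (chirped_window A1 A2 \<phi> f y x) = norm (f x) * norm (\<phi> (x - y))"
  by (simp add: chirped_window_def norm_mult norm_phase)

text \<open>The modulus removes the branch of the square root, so both signs of \<open>r\<close> are
  covered at once.\<close>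

lemma norm_lct_const:
  "u = qi \<or> u = qj \<Longrightarrow> norm (slice u (inverse (csqrt (of_real r)) * cis t)) = 1 / sqrt \<bar>r\<bar>"
  by (simp only: norm_slice norm_mult norm_inverse norm_csqrt norm_of_real norm_cis)
      (simp add: inverse_eq_divide)

abbreviation (input) sqn :: "(real \<times> real \<Rightarrow> quat) \<Rightarrow> ennreal" where
  "sqn f \<equiv> (\<integral>\<^sup>+x. ennreal ((norm (f x))\<^sup>2) \<partial>lborel)"

section \<open>Pointwise and energy bounds for Borel functions\<close>

context
  fixes A1 A2 :: "real^2^2" and f \<phi> :: "real \<times> real \<Rightarrow> quat"
  assumes b: "A1 $ 1 $ 2 \<noteq> 0" "A2 $ 1 $ 2 \<noteq> 0"
    and f [measurable]: "f \<in> borel_measurable borel"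
    and \<phi> [measurable]: "\<phi> \<in> borel_measurable borel"
    and f_L2: "(\<integral>\<^sup>+x. ennreal ((norm (f x))\<^sup>2) \<partial>lborel) < \<infinity>"
    and \<phi>_L2: "(\<integral>\<^sup>+x. ennreal ((norm (\<phi> x))\<^sup>2) \<partial>lborel) < \<infinity>"
begin

abbreviation (input) "b1 \<equiv> A1 $ 1 $ 2"
abbreviation (input) "b2 \<equiv> A2 $ 1 $ 2"

lemma chirped_window_measurable [measurable]: "chirped_window A1 A2 \<phi> f y \<in> borel_measurable borel"
  unfolding chirped_window_def[abs_def] by measurable

text \<open>Cauchy-Schwarz and translation invariance; the bound does not depend on
  \<open>y\<close>.\<close>

lemma chirped_window_L1_le:
  "(\<integral>\<^sup>+x. ennreal (norm (chirped_window A1 A2 \<phi> f y x)) \<partial>lborel)\<^sup>2 \<le> sqn f * sqn \<phi>"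
proof -
  have "(\<integral>\<^sup>+x. ennreal (norm (chirped_window A1 A2 \<phi> f y x)) \<partial>lborel)\<^sup>2
     = (\<integral>\<^sup>+x. ennreal (norm (f x)) * ennreal (norm (\<phi> (x - y))) \<partial>lborel)\<^sup>2"
    by (simp add: norm_chirped_window ennreal_mult)
  also have "\<dots> \<le> (\<integral>\<^sup>+x. (ennreal (norm (f x)))\<^sup>2 \<partial>lborel) *
      (\<integral>\<^sup>+x. (ennreal (norm (\<phi> (x - y))))\<^sup>2 \<partial>lborel)"
    by (rule Cauchy_Schwarz_nn_integral) measurable
  also have "\<dots> = sqn f * sqn \<phi>"
    using nn_integral_lborel_translate[of "\<lambda>x. ennreal ((norm (\<phi> x))\<^sup>2)" "- y"]
    by (simp add: ennreal_power)
  finally show ?thesis .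
qed

lemma chirped_window_integrable: "integrable lborel (chirped_window A1 A2 \<phi> f y)"
proof (rule integrableI_bounded)
  have "sqn f * sqn \<phi> < \<infinity>"
    using f_L2 \<phi>_L2 by (simp add: ennreal_mult_less_top)
  then have "(\<integral>\<^sup>+x. ennreal (norm (chirped_window A1 A2 \<phi> f y x)) \<partial>lborel)\<^sup>2 < \<infinity>"
    using chirped_window_L1_le[of y] by (rule le_less_trans[rotated])
  then show "(\<integral>\<^sup>+x. ennreal (norm (chirped_window A1 A2 \<phi> f y x)) \<partial>lborel) < \<infinity>"
    by (simp add: power_less_top_ennreal)
qed measurable

lemma gabor_qlct_lborel:
  "gabor_qlct A1 A2 \<phi> f \<omega> y = (\<integral>x. lct_kernel qi A1 (fst x) (fst \<omega>) * f x * qcnj (\<phi> (x - y)) *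
        lct_kernel qj A2 (snd x) (snd \<omega>) \<partial>lborel)"
  unfolding gabor_qlct_def by (rule integral_completion) measurable

lemma gabor_qlct_measurable:
  "(\<lambda>p. gabor_qlct A1 A2 \<phi> f (fst p) (snd p)) \<in> borel_measurable borel"
proof -
  have "(\<lambda>(p, x). lct_kernel qi A1 (fst x) (fst (fst p)) * f x * qcnj (\<phi> (x - snd p)) *
        lct_kernel qj A2 (snd x) (snd (fst p))) \<in> borel_measurable (borel \<Otimes>\<^sub>M lborel)"
    by measurable
  then show ?thesis
    unfolding gabor_qlct_lborel by (rule lborel.borel_measurable_lebesgue_integral)
qed

text \<open>The exponent of each kernel splits into a part in the frequency, a mixed part and a
  chirp in \<open>x\<close>. Within a slice these may be ordered freely, so the frequency parts
  leave the integral on their own sides and only their moduli matter.\<close>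

lemma norm_gabor_qlct:
  "norm (gabor_qlct A1 A2 \<phi> f \<omega> y) =
    norm (qft b1 b2 (chirped_window A1 A2 \<phi> f y) \<omega>) / (2 * pi * sqrt \<bar>b1 * b2\<bar>)"
proof -
  let ?H = "chirped_window A1 A2 \<phi> f y"
  \<comment> \<open>The terms of the halved exponent that do not involve the space variable.\<close>
  define r where "r A w = A $ 2 $ 2 / A $ 1 $ 2 * w\<^sup>2 / 2 - pi / 4" for A :: "real^2^2" and w :: real
  define S where "S u A w = slice u (inverse (csqrt (of_real (2 * pi * A $ 1 $ 2))) * cis (r A w))"
    for u and A :: "real^2^2" and w
  have K: "lct_kernel u A t w = S u A w * (phase u (- (t * w / A $ 1 $ 2)) *
      phase u (A $ 1 $ 1 / A $ 1 $ 2 * t\<^sup>2 / 2))"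
    if "u = qi \<or> u = qj" for u A t w
  proof -
    have "(A $ 1 $ 1 / A $ 1 $ 2 * t\<^sup>2 - 2 / A $ 1 $ 2 * t * w + A $ 2 $ 2 / A $ 1 $ 2 * w\<^sup>2 -
        pi / 2) / 2
       = r A w + (- (t * w / A $ 1 $ 2) + A $ 1 $ 1 / A $ 1 $ 2 * t\<^sup>2 / 2)"
      by (simp add: r_def field_simps)
    then show ?thesis
      unfolding lct_kernel_eq[OF unit_sq[OF that]] S_def
      by (simp only: cis_mult[symmetric] slice_mult[OF unit_sq[OF that]] mult.assoc)
  qed
  \<comment> \<open>The mirrored order for the right kernel puts the chirp next to the window and
    the frequency factor outermost.\<close>
  have K': "lct_kernel qj A t w = phase qj (A $ 1 $ 1 / A $ 1 $ 2 * t\<^sup>2 / 2) *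
      (phase qj (- (t * w / A $ 1 $ 2)) * S qj A w)" for A t w
    unfolding K[of qj, simplified] S_def by (simp add: unit_sq mult_ac flip: slice_mult)
  have "gabor_qlct A1 A2 \<phi> f \<omega> y = (\<integral>x. S qi A1 (fst \<omega>) *
      (phase qi (- (fst x * fst \<omega> / b1)) * ?H x * phase qj (- (snd x * snd \<omega> / b2))) *
          S qj A2 (snd \<omega>) \<partial>lborel)"
    unfolding gabor_qlct_lborel K[OF disjI1[OF refl]] K' chirped_window_def by (simp only: mult.assoc)
  also have "\<dots> = S qi A1 (fst \<omega>) * qft b1 b2 ?H \<omega> * S qj A2 (snd \<omega>)"
    unfolding qft_def using qft_integrand_integrable[OF chirped_window_integrable] by simp
  finally have "norm (gabor_qlct A1 A2 \<phi> f \<omega> y) = 1 / sqrt \<bar>2 * pi * b1\<bar> * norm (qft b1 b2 ?H \<omega>) *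
      (1 / sqrt \<bar>2 * pi * b2\<bar>)"
    unfolding S_def by (simp only: norm_mult[where 'a = quat] norm_lct_const simp_thms)
  also have "\<dots> = norm (qft b1 b2 ?H \<omega>) / (sqrt \<bar>2 * pi * b1\<bar> * sqrt \<bar>2 * pi * b2\<bar>)"
    by simp
  also have "sqrt \<bar>2 * pi * b1\<bar> * sqrt \<bar>2 * pi * b2\<bar> = 2 * pi * sqrt \<bar>b1 * b2\<bar>"
  proof -
    have "\<bar>2 * pi * b1\<bar> * \<bar>2 * pi * b2\<bar> = (2 * pi)\<^sup>2 * \<bar>b1 * b2\<bar>"
      by (simp add: abs_mult power2_eq_square)
    then show ?thesis
      by (simp add: real_sqrt_mult[symmetric]) (simp add: real_sqrt_mult)
  qed
  finally show ?thesis .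
qed

text \<open>The transform \<open>qft\<close> is bounded by the L1 norm of the chirped window, which
  Cauchy-Schwarz controls.\<close>

lemma gabor_qlct_bound:
  "ennreal ((norm (gabor_qlct A1 A2 \<phi> f \<omega> y))\<^sup>2) \<le> ennreal (1 / (4 * pi\<^sup>2 * \<bar>b1 * b2\<bar>)) *
      (sqn f * sqn \<phi>)"
proof -
  let ?H = "chirped_window A1 A2 \<phi> f y"
  have "ennreal (norm (qft b1 b2 ?H \<omega>)) \<le> (\<integral>\<^sup>+x. ennreal (norm (?H x)) \<partial>lborel)"
    unfolding qft_def
    by (rule order_trans[OF integral_norm_bound_ennreal[OF
        qft_integrand_integrable[OF chirped_window_integrable]]])
       (simp add: norm_mult norm_phase)
  then have "(ennreal (norm (qft b1 b2 ?H \<omega>)))\<^sup>2 \<le> sqn f * sqn \<phi>"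
    by (intro order_trans[OF power_mono chirped_window_L1_le]) auto
  then have "ennreal (1 / (4 * pi\<^sup>2 * \<bar>b1 * b2\<bar>)) * ennreal ((norm (qft b1 b2 ?H \<omega>))\<^sup>2)
      \<le> ennreal (1 / (4 * pi\<^sup>2 * \<bar>b1 * b2\<bar>)) * (sqn f * sqn \<phi>)"
    by (intro mult_left_mono) (simp_all add: ennreal_power)
  moreover have "(norm (gabor_qlct A1 A2 \<phi> f \<omega> y))\<^sup>2 = 1 / (4 * pi\<^sup>2 * \<bar>b1 * b2\<bar>) *
      (norm (qft b1 b2 ?H \<omega>))\<^sup>2"
    unfolding norm_gabor_qlct by (simp add: power_divide power_mult_distrib)
  ultimately show ?thesis
    by (simp only: ennreal_mult'' zero_le_power2)
qed

text \<open>Integrating the squared window over \<open>y\<close> first makes the norms factor. After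
  Tonelli, the Plancherel inequality is applied for each fixed \<open>y\<close>, and its constant
  cancels the normalisation of the kernels.\<close>

lemma gabor_qlct_energy_ge:
  "sqn f * sqn \<phi> \<le> (\<integral>\<^sup>+p. ennreal ((norm (gabor_qlct A1 A2 \<phi> f (fst p) (snd p)))\<^sup>2) \<partial>lborel)"
proof -
  let ?K = "4 * pi\<^sup>2 * \<bar>b1 * b2\<bar>"
  have "sqn f * sqn \<phi> = (\<integral>\<^sup>+x. ennreal ((norm (f x))\<^sup>2) *
      (\<integral>\<^sup>+y. ennreal ((norm (\<phi> (x - y)))\<^sup>2) \<partial>lborel) \<partial>lborel)"
    using nn_integral_lborel_reflect[of "\<lambda>x. ennreal ((norm (\<phi> x))\<^sup>2)"] by (simp add: nn_integral_multc)
  also have "\<dots> = (\<integral>\<^sup>+x. \<integral>\<^sup>+y. ennreal ((norm (f x))\<^sup>2) * ennreal ((norm (\<phi> (x - y)))\<^sup>2) \<partial>lborel \<partial>lborel)"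
    by (simp add: nn_integral_cmult)
  also have "\<dots> = (\<integral>\<^sup>+y. \<integral>\<^sup>+x. ennreal ((norm (f x))\<^sup>2) * ennreal ((norm (\<phi> (x - y)))\<^sup>2) \<partial>lborel \<partial>lborel)"
    by (rule lborel_pair.Fubini') measurable
  also have "\<dots> \<le> (\<integral>\<^sup>+y. \<integral>\<^sup>+\<omega>. ennreal ((norm (gabor_qlct A1 A2 \<phi> f \<omega> y))\<^sup>2) \<partial>lborel \<partial>lborel)"
  proof (rule nn_integral_mono)
    fix y
    let ?H = "chirped_window A1 A2 \<phi> f y"
    have [measurable]: "qft b1 b2 ?H \<in> borel_measurable borel"
      by (rule qft_measurable) measurable
    have "(\<integral>\<^sup>+x. ennreal ((norm (f x))\<^sup>2) * ennreal ((norm (\<phi> (x - y)))\<^sup>2) \<partial>lborel) = sqn ?H"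
      by (simp add: norm_chirped_window power_mult_distrib ennreal_mult)
    also have "\<dots> = ennreal (1 / ?K) * (ennreal ?K * sqn ?H)"
      using b by (simp add: mult.assoc[symmetric] flip: ennreal_mult)
    also have "\<dots> \<le> ennreal (1 / ?K) * (\<integral>\<^sup>+\<omega>. ennreal ((norm (qft b1 b2 ?H \<omega>))\<^sup>2) \<partial>lborel)"
      by (intro mult_left_mono qft_plancherel_le[OF chirped_window_integrable b]) auto
    also have "\<dots> = (\<integral>\<^sup>+\<omega>. ennreal ((norm (gabor_qlct A1 A2 \<phi> f \<omega> y))\<^sup>2) \<partial>lborel)"
      by (subst nn_integral_cmult[symmetric])
         (auto simp: norm_gabor_qlct power_divide power_mult_distrib simp flip: ennreal_mult
             intro!: nn_integral_cong)
    finally show "(\<integral>\<^sup>+x. ennreal ((norm (f x))\<^sup>2) * ennreal ((norm (\<phi> (x - y)))\<^sup>2) \<partial>lborel)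
       \<le> (\<integral>\<^sup>+\<omega>. ennreal ((norm (gabor_qlct A1 A2 \<phi> f \<omega> y))\<^sup>2) \<partial>lborel)" .
  qed
  also have "\<dots> = (\<integral>\<^sup>+p. ennreal ((norm (gabor_qlct A1 A2 \<phi> f (fst p) (snd p)))\<^sup>2) \<partial>(lborel \<Otimes>\<^sub>M lborel))"
    by (subst lborel_pair.nn_integral_snd[symmetric])
       (use gabor_qlct_measurable in \<open>simp_all add: lborel_prod\<close>)
  finally show ?thesis by (simp add: lborel_prod)
qed

end

section \<open>Concentration on a small ball against a power weight\<close>

lemma ex_small_ball:
  assumes "0 \<le> c"
  obtains r where "0 < r" "c * measure lborel (ball (0::'a::euclidean_space) r) \<le> 1 / 2"
proof
  define V where "V = unit_ball_vol (real DIM('a))"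
  have V: "0 \<le> V" by (simp add: V_def)
  define w where "w = c * V"
  have w: "0 \<le> w" using assms V by (simp add: w_def)
  \<comment> \<open>With \<open>r \<le> 1\<close> the power of \<open>r\<close> is at most
    \<open>r\<close>, so \<open>w * r \<le> 1 / 2\<close> suffices; the added 1 also covers
    \<open>w = 0\<close>.\<close>
  define r where "r = 1 / (2 * w + 1)"
  show r: "0 < r" using w by (simp add: r_def)
  have "r \<le> 1" using w by (simp add: r_def)
  then have "r ^ DIM('a) \<le> r ^ 1"
    using r by (intro power_decreasing) (auto simp: Suc_leI)
  then have "w * r ^ DIM('a) \<le> w * r"
    using w by (intro mult_left_mono) auto
  also have "\<dots> \<le> 1 / 2" using w by (simp add: r_def field_simps)
  finally show "c * measure lborel (ball (0::'a) r) \<le> 1 / 2"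
    using r by (simp add: content_ball V_def w_def mult.assoc)
qed

text \<open>The ball holds at most \<open>X / 2\<close> because the density is bounded there;
  outside it the weight is at least \<open>r powr s\<close>. So \<open>X\<close> is at most
  \<open>X / 2\<close> plus a multiple of the weighted integral, and finiteness of \<open>X\<close>
  permits absorbing the half.\<close>

lemma weighted_energy_lower_bound:
  fixes g :: "'a::euclidean_space \<Rightarrow> ennreal" and X :: ennreal
  assumes [measurable]: "g \<in> borel_measurable borel"
    and X: "X < \<infinity>" and energy: "X \<le> integral\<^sup>N lborel g"
    and bound: "\<And>p. g p \<le> ennreal c * X" and c: "0 \<le> c"
    and r: "0 < r" "c * measure lborel (ball (0::'a) r) \<le> 1 / 2" and s: "0 < s"
  shows "X \<le> ennreal (2 * r powr (- s)) * (\<integral>\<^sup>+p. ennreal (norm p powr s) * g p \<partial>lborel)"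
proof -
  let ?T = "\<integral>\<^sup>+p. ennreal (norm p powr s) * g p \<partial>lborel"
  let ?R = "ennreal (r powr (- s))"
  have pointwise: "g p \<le> ennreal c * X * indicator (ball 0 r) p + ?R *
      (ennreal (norm p powr s) * g p)" for p
  proof (cases "norm p < r")
    case True
    then show ?thesis using bound[of p] by (simp add: add_increasing2)
  next
    case False
    then have "r powr s \<le> norm p powr s"
      using r s by (intro powr_mono2) auto
    then have "1 \<le> r powr (- s) * norm p powr s"
      using r by (simp add: powr_minus field_simps)
    then have "1 \<le> ?R * ennreal (norm p powr s)"
      by (simp flip: ennreal_mult)
    then have "1 * g p \<le> ?R * ennreal (norm p powr s) * g p"
      by (rule mult_right_mono) simp
    then show ?thesis by (simp add: add_increasing mult.assoc)
  qed
  have "X \<le> (\<integral>\<^sup>+p. ennreal c * X * indicator (ball 0 r) p + ?R *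
      (ennreal (norm p powr s) * g p) \<partial>lborel)"
    using energy pointwise by (intro order_trans[OF energy nn_integral_mono]) auto
  also have "\<dots> = ennreal c * X * emeasure lborel (ball (0::'a) r) + ?R * ?T"
  proof -
    have [measurable]: "(\<lambda>p. ennreal (norm p powr s) * g p) \<in> borel_measurable lborel"
      by measurable
    have [measurable]: "(\<lambda>p. ennreal c * X * indicator (ball 0 r) p)
        \<in> borel_measurable (borel :: 'a measure)"
      by (intro borel_measurable_times_ennreal borel_measurable_const borel_measurable_indicator) auto
    show ?thesis
      by (subst nn_integral_add) (auto simp: nn_integral_cmult nn_integral_cmult_indicator)
  qed
  also have "ennreal c * X * emeasure lborel (ball (0::'a) r) =
      ennreal (c * measure lborel (ball (0::'a) r)) * X"
    using c emeasure_bounded_finite[of "ball (0::'a) r"]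
    by (simp add: ennreal_mult mult_ac emeasure_eq_ennreal_measure)
  also have "\<dots> \<le> ennreal (1 / 2) * X"
    using r by (intro mult_right_mono ennreal_leI) auto
  finally have le: "X \<le> ennreal (1 / 2) * X + ?R * ?T"
    by (simp add: add_right_mono)
  show ?thesis
  \<comment> \<open>The absorption is carried out in the reals, so the infinite case is
    separated.\<close>
  proof (cases "?R * ?T = \<infinity>")
    case True
    have "ennreal (2 * r powr (- s)) * ?T = 2 * (?R * ?T)"
      by (simp add: ennreal_mult mult.assoc)
    then show ?thesis using True by (simp add: ennreal_mult_eq_top_iff)
  next
    case False
    obtain x where x: "X = ennreal x" "0 \<le> x" using X by (cases X) auto
    obtain t where t: "?R * ?T = ennreal t" "0 \<le> t" using False by (cases "?R * ?T") auto
    have "ennreal (1 / 2 * x + t) = ennreal (1 / 2) * ennreal x + ennreal t"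
      using x(2) t(2) by (simp only: ennreal_plus ennreal_mult mult_nonneg_nonneg
          zero_le_divide_1_iff zero_le_numeral)
    then have "ennreal x \<le> ennreal (1 / 2 * x + t)"
      using le unfolding x(1) t(1) by metis
    then have "x \<le> 1 / 2 * x + t"
      using x(2) t(2) by (subst (asm) ennreal_le_iff) auto
    then have "x \<le> 2 * t" by simp
    then have "X \<le> 2 * (?R * ?T)"
      unfolding x(1) t(1) using t(2) by (simp add: ennreal_mult[symmetric] flip: ennreal_numeral)
    then show ?thesis by (simp add: ennreal_mult mult.assoc)
  qed
qed

section \<open>Passage to Lebesgue measurable functions and conclusion\<close>

lemma gabor_qlct_cong_AE:
  assumes "f \<in> borel_measurable lebesgue" "\<phi> \<in> borel_measurable lebesgue"
    and [measurable]: "f' \<in> borel_measurable borel" "\<phi>' \<in> borel_measurable borel"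
    and "AE x in lborel. f x = f' x" "AE x in lborel. \<phi> x = \<phi>' x"
  shows "gabor_qlct A1 A2 \<phi> f \<omega> y = gabor_qlct A1 A2 \<phi>' f' \<omega> y"
  unfolding gabor_qlct_def
proof (rule integral_cong_AE)
  have [measurable]: "f \<in> borel_measurable lebesgue" "(\<lambda>x. \<phi> (x - y)) \<in> borel_measurable lebesgue"
    using assms(1) lebesgue_measurable_translate[OF assms(2), of "- y"] by simp_all
  have [measurable]: "(\<lambda>x. lct_kernel qi A1 (fst x) (fst \<omega>)) \<in> borel_measurable lebesgue"
     "(\<lambda>x. lct_kernel qj A2 (snd x) (snd \<omega>)) \<in> borel_measurable lebesgue"
    by (intro measurable_completion lct_kernel_measurable; simp)+
  show "(\<lambda>x. lct_kernel qi A1 (fst x) (fst \<omega>) * f x * qcnj (\<phi> (x - y)) *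
      lct_kernel qj A2 (snd x) (snd \<omega>)) \<in> borel_measurable lebesgue"
    by measurable
  show "(\<lambda>x. lct_kernel qi A1 (fst x) (fst \<omega>) * f' x * qcnj (\<phi>' (x - y)) *
      lct_kernel qj A2 (snd x) (snd \<omega>)) \<in> borel_measurable lebesgue"
    by (intro measurable_completion) measurable
  \<comment> \<open>Translates of null sets are null, so the transforms agree at every point and not
    just almost everywhere.\<close>
  have "AE x in lborel. \<phi> (x - y) = \<phi>' (x - y)"
    using AE_lborel_translate[OF assms(6), of "- y"] by simp
  then have "AE x in lborel. lct_kernel qi A1 (fst x) (fst \<omega>) * f x * qcnj (\<phi> (x - y)) *
      lct_kernel qj A2 (snd x) (snd \<omega>) =
     lct_kernel qi A1 (fst x) (fst \<omega>) * f' x * qcnj (\<phi>' (x - y)) * lct_kernel qj A2 (snd x) (snd \<omega>)"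
    using assms(5) by eventually_elim simp
  then show "AE x in lebesgue. lct_kernel qi A1 (fst x) (fst \<omega>) * f x * qcnj (\<phi> (x - y)) *
      lct_kernel qj A2 (snd x) (snd \<omega>) =
     lct_kernel qi A1 (fst x) (fst \<omega>) * f' x * qcnj (\<phi>' (x - y)) * lct_kernel qj A2 (snd x) (snd \<omega>)"
    by (rule AE_completion)
qed

lemma L2_quat_borel_representative:
  assumes "f \<in> L2_quat"
  obtains g where "g \<in> borel_measurable borel" "AE x in lborel. f x = g x"
    "(\<integral>\<^sup>+x. ennreal ((norm (g x))\<^sup>2) \<partial>lborel) = ennreal ((L2_norm_quat f)\<^sup>2)"
proof -
  have f: "f \<in> borel_measurable lebesgue" "(\<integral>\<^sup>+x. ennreal ((norm (f x))\<^sup>2) \<partial>lebesgue) < \<infinity>"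
    using assms by (auto simp: L2_quat_def)
  obtain g where g: "g \<in> borel_measurable borel" "AE x in lborel. f x = g x"
    using lebesgue_ex_borel_AE_eq[OF f(1)] .
  have "integrable lebesgue (\<lambda>x. (norm (f x))\<^sup>2)"
    using f by (intro integrableI_bounded) auto
  then have "(\<integral>\<^sup>+x. ennreal ((norm (f x))\<^sup>2) \<partial>lebesgue) = ennreal ((L2_norm_quat f)\<^sup>2)"
    by (simp add: nn_integral_eq_integral L2_norm_quat_def)
  moreover have "(\<integral>\<^sup>+x. ennreal ((norm (g x))\<^sup>2) \<partial>lborel) = (\<integral>\<^sup>+x. ennreal ((norm (f x))\<^sup>2) \<partial>lborel)"
    by (intro nn_integral_cong_AE) (use g(2) in \<open>auto elim: eventually_mono\<close>)
  ultimately show thesis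
    using that[OF g] by (simp add: nn_integral_completion)
qed

theorem theorem3p13:
  fixes A1 A2 :: "real^2^2" and s :: real
  assumes "A1 $ 1 $ 1 * A1 $ 2 $ 2 - A1 $ 1 $ 2 * A1 $ 2 $ 1 = 1"
    and "A2 $ 1 $ 1 * A2 $ 2 $ 2 - A2 $ 1 $ 2 * A2 $ 2 $ 1 = 1"
    and "A1 $ 1 $ 2 * A2 $ 1 $ 2 \<noteq> 0"
    and "s > 0"
  shows "\<exists>C>0. \<forall>f\<in>L2_quat. \<forall>\<phi>\<in>L2_quat.
    ennreal (L2_norm_quat f * L2_norm_quat \<phi>) \<le>
      ennreal C * ennreal_sqrt
        (\<integral>\<^sup>+ (\<omega>, y). ennreal (norm (\<omega>, y) powr (2 * s) *
           (norm (gabor_qlct A1 A2 \<phi> f \<omega> y))\<^sup>2) \<partial>lebesgue)"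
proof -
  have b: "A1 $ 1 $ 2 \<noteq> 0" "A2 $ 1 $ 2 \<noteq> 0" using assms(3) by auto
  \<comment> \<open>The constant of the pointwise bound. It depends on the matrices alone, hence so
    does the radius \<open>r\<close>, and \<open>C\<close> is uniform in \<open>f\<close> and
    \<open>\<phi>\<close>.\<close>
  define c where "c = 1 / (4 * pi\<^sup>2 * \<bar>A1 $ 1 $ 2 * A2 $ 1 $ 2\<bar>)"
  have c: "0 \<le> c" by (simp add: c_def)
  obtain r where r: "0 < r" "c * measure lborel (ball (0 :: (real \<times> real) \<times> (real \<times> real)) r) \<le> 1 / 2"
    using ex_small_ball[OF c] .
  \<comment> \<open>A square root, since the energy estimate with weight exponent
    \<open>2 * s\<close> compares squares.\<close>
  define C where "C = sqrt (2 * r powr (- (2 * s)))"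
  have C: "0 < C" using r by (simp add: C_def)
  have "ennreal (L2_norm_quat f * L2_norm_quat \<phi>) \<le> ennreal C * ennreal_sqrt
        (\<integral>\<^sup>+ (\<omega>, y). ennreal (norm (\<omega>, y) powr (2 * s) * (norm (gabor_qlct A1 A2 \<phi> f \<omega> y))\<^sup>2) \<partial>lebesgue)"
      (is "_ \<le> _ * ennreal_sqrt ?T")
    if f: "f \<in> L2_quat" and \<phi>: "\<phi> \<in> L2_quat" for f \<phi>
  proof -
    obtain f' where f': "f' \<in> borel_measurable borel" "AE x in lborel. f x = f' x"
      "(\<integral>\<^sup>+x. ennreal ((norm (f' x))\<^sup>2) \<partial>lborel) = ennreal ((L2_norm_quat f)\<^sup>2)"
      using L2_quat_borel_representative[OF f] .
    obtain \<phi>' where \<phi>': "\<phi>' \<in> borel_measurable borel" "AE x in lborel. \<phi> x = \<phi>' x"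
      "(\<integral>\<^sup>+x. ennreal ((norm (\<phi>' x))\<^sup>2) \<partial>lborel) = ennreal ((L2_norm_quat \<phi>)\<^sup>2)"
      using L2_quat_borel_representative[OF \<phi>] .
    have fin: "(\<integral>\<^sup>+x. ennreal ((norm (f' x))\<^sup>2) \<partial>lborel) < \<infinity>"
      "(\<integral>\<^sup>+x. ennreal ((norm (\<phi>' x))\<^sup>2) \<partial>lborel) < \<infinity>"
      unfolding f'(3) \<phi>'(3) by simp_all
    have cong: "gabor_qlct A1 A2 \<phi> f \<omega> y = gabor_qlct A1 A2 \<phi>' f' \<omega> y" for \<omega> y
      using f \<phi> by (intro gabor_qlct_cong_AE f' \<phi>') (auto simp: L2_quat_def)
    let ?g = "\<lambda>p. ennreal ((norm (gabor_qlct A1 A2 \<phi>' f' (fst p) (snd p)))\<^sup>2)"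
    define n where "n = L2_norm_quat f * L2_norm_quat \<phi>"
    have n: "0 \<le> n" by (simp add: n_def L2_norm_quat_def)
    have X: "ennreal ((L2_norm_quat f)\<^sup>2) * ennreal ((L2_norm_quat \<phi>)\<^sup>2) = ennreal (n\<^sup>2)"
      by (simp add: n_def power_mult_distrib ennreal_mult)
    have "ennreal (n\<^sup>2) \<le> ennreal (2 * r powr (- (2 * s))) *
        (\<integral>\<^sup>+p. ennreal (norm p powr (2 * s)) * ?g p \<partial>lborel)"
    proof (rule weighted_energy_lower_bound[OF _ _ _ _ c r])
      show "?g \<in> borel_measurable borel"
        using gabor_qlct_measurable[OF b f'(1) \<phi>'(1) fin] by measurable
      show "ennreal (n\<^sup>2) \<le> integral\<^sup>N lborel ?g"
        using gabor_qlct_energy_ge[OF b f'(1) \<phi>'(1) fin] unfolding f'(3) \<phi>'(3) X .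
      show "?g p \<le> ennreal c * ennreal (n\<^sup>2)" for p
        using gabor_qlct_bound[OF b f'(1) \<phi>'(1) fin, of "fst p" "snd p"] unfolding f'(3) \<phi>'(3) X c_def .
    qed (use assms(4) in auto)
    also have "(\<integral>\<^sup>+p. ennreal (norm p powr (2 * s)) * ?g p \<partial>lborel) = ?T"
      by (simp add: nn_integral_completion cong ennreal_mult case_prod_beta')
    finally have le: "ennreal (n\<^sup>2) \<le> ennreal (2 * r powr (- (2 * s))) * ?T" .
    show "ennreal (L2_norm_quat f * L2_norm_quat \<phi>) \<le> ennreal C * ennreal_sqrt ?T"
    \<comment> \<open>If the weighted integral diverges, the right side is infinite because
      \<open>C\<close> is positive; in \<open>ennreal\<close>, zero times infinity would be
      zero.\<close>
    proof (cases "?T = \<infinity>")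
      case True
      then show ?thesis using C by (simp add: ennreal_sqrt_def ennreal_mult_eq_top_iff)
    next
      case False
      then obtain t where t: "?T = ennreal t" "0 \<le> t" by (cases ?T) auto
      have "n\<^sup>2 \<le> 2 * r powr (- (2 * s)) * t"
        using le unfolding t(1) using t(2) by (simp flip: ennreal_mult)
      then have "sqrt (n\<^sup>2) \<le> sqrt (2 * r powr (- (2 * s)) * t)"
        by (rule real_sqrt_le_mono)
      then have "n \<le> C * sqrt t"
        using n by (simp add: C_def real_sqrt_mult)
      then show ?thesis
        unfolding t(1) using t(2) C by (simp add: ennreal_sqrt_def n_def ennreal_leI flip: ennreal_mult)
    qed
  qed
  then show ?thesis using C by blast
qed

end
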